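(* Let $R$ and $S$ be iTRSs over disjoint signatures and let $R+S$ be their disjoint union. If $R+S$ is convergent, then $R$ and $S$ are convergent; and if $R+S$ is strongly convergent, then $R$ and $S$ are strongly convergent.
   Context: An ultra-metric map (umm) of arity $n$ is $f:[0,1]^n\to[0,1]$ with $f(\vec x)=0$ iff all $x_i=0$ and distributing over componentwise $\max$. A term metric $m$ assigns each $n$-ary function symbol $F$ a continuous $n$-ary umm $F_m$; the distance $d_m$ on finite terms is $d_m(t,t)=0$, $1$ for different root symbols, and $d_m(F(\vec t),F(\vec u))=F_m(d_m(t_1,u_1),\dots,d_m(t_n,u_n))$; $\mathrm{Ter}_m$ is its metric completion. An iTRS $(\Sigma,m,R)$ has a signature, a term metric, and rules $l\to r$ in $\mathrm{Ter}_m$ with $l$ not a variable and variables of $r$ occurring in $l$; its rewrite relation is the closure under substitutions and contexts. A reduction sequence is a continuous $f:\alpha\to\mathrm{Ter}_m$ ($\alpha$ an ordinal, order topology) with $f(\beta)\to f(\beta+1)$ for $\beta+1<\alpha$; open if $\alpha$ is a limit; an open sequence converges if it extends continuously to $\alpha+1$. The iTRS is convergent if all open reduction sequences converge. The indirected version of $(\Sigma,m,R)$ adds a fresh unary symbol $I$ with $I_m(x)=x$, replaces each rule $l\to r$ by $l\to I(r)$, and adds the rule $I(x)\to x$; the iTRS is strongly convergent if its indirected version is convergent. The disjoint union $R+S$ of iTRSs with disjoint signatures has the union of signatures, the union of rules, and the term metric agreeing with each constituent's term metric on its symbols. *)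

theory Defs
  imports "HOL-Analysis.Analysis"
begin

section \<open>Ultra-metric maps\<close>

text \<open>Points of \<open>[0,1]\<^sup>n\<close> are functions \<open>nat \<Rightarrow> real\<close> on the index set \<open>{..<n}\<close>, extensional outside it,
  so that the library product topology applies for every \<open>n\<close>.\<close>

abbreviation cube :: "nat \<Rightarrow> (nat \<Rightarrow> real) set" where
  "cube n \<equiv> {..<n} \<rightarrow>\<^sub>E {0..1}"

definition umm :: "nat \<Rightarrow> ((nat \<Rightarrow> real) \<Rightarrow> real) \<Rightarrow> bool" where
  "umm n f \<longleftrightarrow>
     f \<in> cube n \<rightarrow> {0..1} \<and>
     (\<forall>x\<in>cube n. f x = 0 \<longleftrightarrow> (\<forall>i<n. x i = 0)) \<and>
     (\<forall>x\<in>cube n. \<forall>y\<in>cube n. f (\<lambda>i\<in>{..<n}. max (x i) (y i)) = max (f x) (f y))"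

definition continuous_umm :: "nat \<Rightarrow> ((nat \<Rightarrow> real) \<Rightarrow> real) \<Rightarrow> bool" where
  "continuous_umm n f \<longleftrightarrow>
     umm n f \<and>
     continuous_map (product_topology (\<lambda>_. top_of_set {0..1}) {..<n}) (top_of_set {0..1}) f"


section \<open>Finite terms and their distance\<close>

datatype ('f, 'v) fterm = Var 'v | Fun 'f "('f, 'v) fterm list"

record 'f msig =
  symbols :: "'f set"
  arity :: "'f \<Rightarrow> nat"
  umap :: "'f \<Rightarrow> (nat \<Rightarrow> real) \<Rightarrow> real"

definition term_metric :: "'f msig \<Rightarrow> bool" where
  "term_metric \<Sigma> \<longleftrightarrow> (\<forall>F\<in>symbols \<Sigma>. continuous_umm (arity \<Sigma> F) (umap \<Sigma> F))"

inductive_set fin_terms :: "'f msig \<Rightarrow> ('f, 'v) fterm set" for \<Sigma> :: "'f msig" where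
  Var: "Var x \<in> fin_terms \<Sigma>"
| Fun: "\<lbrakk>F \<in> symbols \<Sigma>; length ts = arity \<Sigma> F; \<forall>t\<in>set ts. t \<in> fin_terms \<Sigma>\<rbrakk>
        \<Longrightarrow> Fun F ts \<in> fin_terms \<Sigma>"

text \<open>Variables act as nullary symbols. The conditional expression is \<open>restrict\<close>, unfolded.\<close>

function (sequential) pre_dist ::
    "('f \<Rightarrow> (nat \<Rightarrow> real) \<Rightarrow> real) \<Rightarrow> ('f, 'v) fterm \<Rightarrow> ('f, 'v) fterm \<Rightarrow> real" where
  "pre_dist m (Var x) (Var y) = (if x = y then 0 else 1)"
| "pre_dist m (Fun F ts) (Fun G us) =
     (if F = G
      then m F (\<lambda>i. if i < length ts then pre_dist m (ts ! i) (us ! i) else undefined)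
      else 1)"
| "pre_dist m t u = 1"
  by pat_completeness auto
termination
  by (relation "Wellfounded.measure (\<lambda>(m, t, u). size t)")
     (auto simp: less_Suc_eq_le intro!: size_list_estimation'[OF nth_mem])

text \<open>The library's \<open>Metric_space\<close> asks for symmetry and nonnegativity on the whole type,
  hence the default value outside the carrier, here and for \<open>completion_dist\<close> below.\<close>

definition fin_dist :: "'f msig \<Rightarrow> ('f, 'v) fterm \<Rightarrow> ('f, 'v) fterm \<Rightarrow> real" where
  "fin_dist \<Sigma> t u =
     (if t \<in> fin_terms \<Sigma> \<and> u \<in> fin_terms \<Sigma> then pre_dist (umap \<Sigma>) t u else 0)"


section \<open>Metric completion\<close>

text \<open>Cauchy sequences modulo having distance tending to \<open>0\<close>.\<close>

definition cauchy_rel :: "'a set \<Rightarrow> ('a \<Rightarrow> 'a \<Rightarrow> real) \<Rightarrow> (nat \<Rightarrow> 'a) rel" where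
  "cauchy_rel M d =
     {(s, t). Metric_space.MCauchy M d s \<and> Metric_space.MCauchy M d t \<and>
              (\<lambda>n. d (s n) (t n)) \<longlonglongrightarrow> 0}"

definition completion :: "'a set \<Rightarrow> ('a \<Rightarrow> 'a \<Rightarrow> real) \<Rightarrow> (nat \<Rightarrow> 'a) set set" where
  "completion M d = {s. Metric_space.MCauchy M d s} // cauchy_rel M d"

definition completion_dist ::
    "'a set \<Rightarrow> ('a \<Rightarrow> 'a \<Rightarrow> real) \<Rightarrow> (nat \<Rightarrow> 'a) set \<Rightarrow> (nat \<Rightarrow> 'a) set \<Rightarrow> real" where
  "completion_dist M d A B =
     (if A \<in> completion M d \<and> B \<in> completion M d
      then THE r. \<forall>s\<in>A. \<forall>t\<in>B. (\<lambda>n. d (s n) (t n)) \<longlonglongrightarrow> r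
      else 0)"


section \<open>The space of terms\<close>

type_synonym ('f, 'v) ter = "(nat \<Rightarrow> ('f, 'v) fterm) set"

definition Ter :: "'f msig \<Rightarrow> ('f, 'v) ter set" where
  "Ter \<Sigma> = completion (fin_terms \<Sigma>) (fin_dist \<Sigma>)"

definition ter_dist :: "'f msig \<Rightarrow> ('f, 'v) ter \<Rightarrow> ('f, 'v) ter \<Rightarrow> real" where
  "ter_dist \<Sigma> = completion_dist (fin_terms \<Sigma>) (fin_dist \<Sigma>)"

definition ter_topology :: "'f msig \<Rightarrow> ('f, 'v) ter topology" where
  "ter_topology \<Sigma> = Metric_space.mtopology (Ter \<Sigma>) (ter_dist \<Sigma>)"

abbreviation ter_rel :: "'f msig \<Rightarrow> (nat \<Rightarrow> ('f, 'v) fterm) rel" where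
  "ter_rel \<Sigma> \<equiv> cauchy_rel (fin_terms \<Sigma>) (fin_dist \<Sigma>)"

definition ter_var :: "'f msig \<Rightarrow> 'v \<Rightarrow> ('f, 'v) ter" where
  "ter_var \<Sigma> x = ter_rel \<Sigma> `` {\<lambda>_. Var x}"

text \<open>Application of a function symbol and renaming of function symbols act pointwise on
  representing sequences; the relational image yields the class of the results.\<close>

definition ter_app :: "'f msig \<Rightarrow> 'f \<Rightarrow> ('f, 'v) ter list \<Rightarrow> ('f, 'v) ter" where
  "ter_app \<Sigma> F cs =
     ter_rel \<Sigma> `` {\<lambda>k. Fun F (map (\<lambda>s. s k) ss) | ss. list_all2 (\<in>) ss cs}"

definition ter_embed :: "'g msig \<Rightarrow> ('f \<Rightarrow> 'g) \<Rightarrow> ('f, 'v) ter \<Rightarrow> ('g, 'v) ter" where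
  "ter_embed \<Sigma> \<phi> c = ter_rel \<Sigma> `` ((\<lambda>s k. map_fterm \<phi> id (s k)) ` c)"

inductive occurs :: "'f msig \<Rightarrow> 'v \<Rightarrow> ('f, 'v) ter \<Rightarrow> bool" for \<Sigma> :: "'f msig" and x :: 'v where
  "occurs \<Sigma> x (ter_var \<Sigma> x)"
| "\<lbrakk>F \<in> symbols \<Sigma>; length cs = arity \<Sigma> F; set cs \<subseteq> Ter \<Sigma>; c \<in> set cs; occurs \<Sigma> x c\<rbrakk>
   \<Longrightarrow> occurs \<Sigma> x (ter_app \<Sigma> F cs)"

primrec fin_subst :: "'f msig \<Rightarrow> ('v \<Rightarrow> ('f, 'v) ter) \<Rightarrow> ('f, 'v) fterm \<Rightarrow> ('f, 'v) ter" where
  "fin_subst \<Sigma> \<sigma> (Var x) = \<sigma> x"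
| "fin_subst \<Sigma> \<sigma> (Fun F ts) = ter_app \<Sigma> F (map (fin_subst \<Sigma> \<sigma>) ts)"

text \<open>Substitution is non-expansive on finite terms; on \<open>Ter\<close> it is the continuous extension.\<close>

definition ter_subst :: "'f msig \<Rightarrow> ('v \<Rightarrow> ('f, 'v) ter) \<Rightarrow> ('f, 'v) ter \<Rightarrow> ('f, 'v) ter" where
  "ter_subst \<Sigma> \<sigma> c =
     (THE u. \<forall>s\<in>c. limitin (ter_topology \<Sigma>) (\<lambda>k. fin_subst \<Sigma> \<sigma> (s k)) u sequentially)"


section \<open>Infinitary term rewriting systems\<close>

record ('f, 'v) itrs =
  sig :: "'f msig"
  rules :: "(('f, 'v) ter \<times> ('f, 'v) ter) set"

definition is_itrs :: "('f, 'v) itrs \<Rightarrow> bool" where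
  "is_itrs R \<longleftrightarrow>
     term_metric (sig R) \<and>
     (\<forall>(l, r)\<in>rules R.
        l \<in> Ter (sig R) \<and> r \<in> Ter (sig R) \<and>
        (\<forall>x. l \<noteq> ter_var (sig R) x) \<and>
        (\<forall>x. occurs (sig R) x r \<longrightarrow> occurs (sig R) x l))"

inductive rstep :: "('f, 'v) itrs \<Rightarrow> ('f, 'v) ter \<Rightarrow> ('f, 'v) ter \<Rightarrow> bool"
    for R :: "('f, 'v) itrs" where
  rule: "(l, r) \<in> rules R \<Longrightarrow> rstep R l r"
| subst: "\<lbrakk>rstep R t u; \<forall>x. \<sigma> x \<in> Ter (sig R)\<rbrakk>
          \<Longrightarrow> rstep R (ter_subst (sig R) \<sigma> t) (ter_subst (sig R) \<sigma> u)"
| ctxt: "\<lbrakk>rstep R t u; F \<in> symbols (sig R); length cs = arity (sig R) F;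
             set cs \<subseteq> Ter (sig R); i < length cs\<rbrakk>
            \<Longrightarrow> rstep R (ter_app (sig R) F (cs[i := t])) (ter_app (sig R) F (cs[i := u]))"


section \<open>Transfinite reduction sequences\<close>

text \<open>An ordinal \<open>\<alpha>\<close> is a well-order relation \<open>r\<close>, its elements being \<open>Field r\<close>.\<close>

definition ord_topology :: "'i rel \<Rightarrow> 'i topology" where
  "ord_topology r =
     topology_generated_by
       ({Field r} \<union> {underS r a | a. a \<in> Field r} \<union> {aboveS r a | a. a \<in> Field r})"

definition ord_succ :: "'i rel \<Rightarrow> 'i option rel" where
  "ord_succ r = map_prod Some Some ` r \<union> (Some ` Field r \<union> {None}) \<times> {None}"

definition limit_ord :: "'i rel \<Rightarrow> bool" where
  "limit_ord r \<longleftrightarrow> Well_order r \<and> Field r \<noteq> {} \<and> (\<forall>a\<in>Field r. aboveS r a \<noteq> {})"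

definition reduction_seq :: "('f, 'v) itrs \<Rightarrow> 'i rel \<Rightarrow> ('i \<Rightarrow> ('f, 'v) ter) \<Rightarrow> bool" where
  "reduction_seq R r f \<longleftrightarrow>
     Well_order r \<and>
     continuous_map (ord_topology r) (ter_topology (sig R)) f \<and>
     (\<forall>\<beta>\<in>Field r. aboveS r \<beta> \<noteq> {} \<longrightarrow> rstep R (f \<beta>) (f (wo_rel.suc r {\<beta>})))"

definition seq_converges :: "('f, 'v) itrs \<Rightarrow> 'i rel \<Rightarrow> ('i \<Rightarrow> ('f, 'v) ter) \<Rightarrow> bool" where
  "seq_converges R r f \<longleftrightarrow>
     (\<exists>g. continuous_map (ord_topology (ord_succ r)) (ter_topology (sig R)) g \<and>
          (\<forall>\<beta>\<in>Field r. g (Some \<beta>) = f \<beta>))"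

text \<open>HOL has no type of all ordinals. The type argument bounds the ordinals considered: they are
  those of well-orders on subsets of \<open>'i\<close>. Results are to be stated for an arbitrary \<open>'i\<close>.\<close>

definition itrs_convergent :: "'i itself \<Rightarrow> ('f, 'v) itrs \<Rightarrow> bool" where
  "itrs_convergent _ R \<longleftrightarrow>
     (\<forall>(r :: 'i rel) f. limit_ord r \<and> reduction_seq R r f \<longrightarrow> seq_converges R r f)"


section \<open>Indirection and strong convergence\<close>

text \<open>The fresh symbol \<open>I\<close> is \<open>None\<close>. The rule \<open>I(x) \<rightarrow> x\<close> is included for every name of the
  variable \<open>x\<close>; by closure under substitutions this does not affect the rewrite relation.\<close>

definition indirect_sig :: "'f msig \<Rightarrow> 'f option msig" where
  "indirect_sig \<Sigma> =
     \<lparr>symbols = insert None (Some ` symbols \<Sigma>),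
      arity = case_option 1 (arity \<Sigma>),
      umap = case_option (\<lambda>x. x 0) (umap \<Sigma>)\<rparr>"

definition indirected :: "('f, 'v) itrs \<Rightarrow> ('f option, 'v) itrs" where
  "indirected R =
     (let \<Sigma> = indirect_sig (sig R) in
      \<lparr>sig = \<Sigma>,
       rules = {(ter_embed \<Sigma> Some l, ter_app \<Sigma> None [ter_embed \<Sigma> Some r]) | l r. (l, r) \<in> rules R}
             \<union> {(ter_app \<Sigma> None [ter_var \<Sigma> x], ter_var \<Sigma> x) | x. True}\<rparr>)"

definition strongly_convergent :: "'i itself \<Rightarrow> ('f, 'v) itrs \<Rightarrow> bool" where
  "strongly_convergent I R \<longleftrightarrow> itrs_convergent I (indirected R)"


section \<open>Disjoint union\<close>

definition disjoint_sigs :: "'f msig \<Rightarrow> 'f msig \<Rightarrow> bool" where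
  "disjoint_sigs \<Sigma> \<Delta> \<longleftrightarrow> symbols \<Sigma> \<inter> symbols \<Delta> = {}"

definition sig_union :: "'f msig \<Rightarrow> 'f msig \<Rightarrow> 'f msig" where
  "sig_union \<Sigma> \<Delta> =
     \<lparr>symbols = symbols \<Sigma> \<union> symbols \<Delta>,
      arity = (\<lambda>F. if F \<in> symbols \<Sigma> then arity \<Sigma> F else arity \<Delta> F),
      umap = (\<lambda>F. if F \<in> symbols \<Sigma> then umap \<Sigma> F else umap \<Delta> F)\<rparr>"

text \<open>Classes of Cauchy sequences over the smaller signatures are not classes over the union,
  so the rules are transported along the canonical embeddings.\<close>

definition itrs_union :: "('f, 'v) itrs \<Rightarrow> ('f, 'v) itrs \<Rightarrow> ('f, 'v) itrs" where
  "itrs_union R S =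
     (let \<Sigma> = sig_union (sig R) (sig S); \<iota> = ter_embed \<Sigma> id in
      \<lparr>sig = \<Sigma>, rules = map_prod \<iota> \<iota> ` rules R \<union> map_prod \<iota> \<iota> ` rules S\<rparr>)"

end

theory Submission
  imports Defs
begin

text \<open>An arity- and metric-preserving injection of signatures extends to an isometric embedding
  of the term spaces that commutes with variables, application of symbols and substitution.
  Hence it maps rewrite steps to rewrite steps, and reduction sequences to reduction sequences.
  If the image of an open sequence converges, its limit lies in the closure of the image of the
  smaller term space. That space is complete, so its image is closed and the limit can be pulled
  back. Both constituents of a disjoint union embed in this way, and indirection preserves
  embeddings, which settles strong convergence.\<close>

section \<open>Metric completion\<close>

text \<open>A term is a class of Cauchy sequences over its own signature, so even along an inclusion
  of signatures the smaller term space need not be a subset of the larger one;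
  \<open>ter_embed\<close> does all the transport. Isometry, rather than mere continuity, is what
  lets anything return: a sequence with Cauchy image is Cauchy, and a map into the smaller space
  with continuous image is continuous. Rewrite steps travel forward only; what comes back is the
  limit point.

  Each condition on an umm serves one layer: distributivity over max gives monotonicity and the
  strong triangle inequality, the condition on zero separates terms, and continuity lets symbols act
  on the completion.

  The argument is stated for embeddings rather than unions because indirecting a union is not the
  disjoint union of the indirected systems: the constituents share one fresh symbol. Yet each
  indirected constituent embeds in the indirected union.

  The length of an open sequence may have uncountable cofinality, so its limit is approached through
  neighbourhoods of the top point; countable sequences enter only once distances have replaced the
  ordinal.\<close>

context Metric_space
begin

lemma MCauchy_in_space: "MCauchy s \<Longrightarrow> s n \<in> M"
  by (auto simp: MCauchy_def)

lemma mdist_diff_le: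
  assumes "a \<in> M" "b \<in> M" "a' \<in> M" "b' \<in> M"
  shows "\<bar>d a b - d a' b'\<bar> \<le> d a a' + d b b'"
  using triangle[of a a' b] triangle[of a' b' b] triangle[of a' a b'] triangle[of a b b'] assms
  by (simp add: commute)

lemma convergent_mdist:
  assumes "MCauchy s" "MCauchy t"
  shows "convergent (\<lambda>n. d (s n) (t n))"
proof -
  have "Cauchy (\<lambda>n. d (s n) (t n))"
  proof (rule metric_CauchyI)
    fix e :: real assume "0 < e"
    then obtain A B where A: "\<forall>n n'. A \<le> n \<longrightarrow> A \<le> n' \<longrightarrow> d (s n) (s n') < e/2"
      and B: "\<forall>n n'. B \<le> n \<longrightarrow> B \<le> n' \<longrightarrow> d (t n) (t n') < e/2"
      using assms unfolding MCauchy_def by (meson half_gt_zero)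
    have "dist (d (s m) (t m)) (d (s n) (t n)) < e" if "m \<ge> max A B" "n \<ge> max A B" for m n
    proof -
      have "d (s m) (s n) < e/2" "d (t m) (t n) < e/2"
        using A B that by auto
      then show ?thesis
        using mdist_diff_le[of "s m" "t m" "s n" "t n"] assms
        by (simp add: MCauchy_in_space dist_real_def)
    qed
    then show "\<exists>N. \<forall>m\<ge>N. \<forall>n\<ge>N. dist (d (s m) (t m)) (d (s n) (t n)) < e"
      by blast
  qed
  then show ?thesis
    by (rule Cauchy_convergent)
qed

text \<open>This makes the distance of two classes independent of the representatives. Applied to
  the pair (s, s) it also yields transitivity of \<open>cauchy_rel\<close>.\<close>

lemma mdist_lim_cong:
  assumes st: "(s, s') \<in> cauchy_rel M d" "(t, t') \<in> cauchy_rel M d"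
    and lim: "(\<lambda>n. d (s n) (t n)) \<longlonglongrightarrow> r"
  shows "(\<lambda>n. d (s' n) (t' n)) \<longlonglongrightarrow> r"
proof -
  have C: "MCauchy s" "MCauchy s'" "MCauchy t" "MCauchy t'"
    and z: "(\<lambda>n. d (s n) (s' n)) \<longlonglongrightarrow> 0" "(\<lambda>n. d (t n) (t' n)) \<longlonglongrightarrow> 0"
    using st by (auto simp: cauchy_rel_def)
  have "(\<lambda>n. d (s n) (s' n) + d (t n) (t' n)) \<longlonglongrightarrow> 0"
    using tendsto_add[OF z] by simp
  moreover have "norm (d (s' n) (t' n) - d (s n) (t n)) \<le> d (s n) (s' n) + d (t n) (t' n)" for n
    using mdist_diff_le[of "s n" "t n" "s' n" "t' n"] C by (simp add: MCauchy_in_space)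
  ultimately have "(\<lambda>n. d (s' n) (t' n) - d (s n) (t n)) \<longlonglongrightarrow> 0"
    by (rule Lim_null_comparison[rotated, OF _ always_eventually, OF _ allI])
  then show ?thesis
    using tendsto_add[OF _ lim, of "\<lambda>n. d (s' n) (t' n) - d (s n) (t n)" 0] by simp
qed

lemma equiv_cauchy_rel: "equiv {s. MCauchy s} (cauchy_rel M d)"
proof (rule equivI)
  show "cauchy_rel M d \<subseteq> {s. MCauchy s} \<times> {s. MCauchy s}"
    by (auto simp: cauchy_rel_def)
  show "refl_on {s. MCauchy s} (cauchy_rel M d)"
    by (auto simp: refl_on_def cauchy_rel_def MCauchy_in_space)
  show "sym (cauchy_rel M d)"
    by (auto simp: sym_def cauchy_rel_def commute)
  show "trans (cauchy_rel M d)"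
  proof (rule transI)
    fix s t u assume st: "(s, t) \<in> cauchy_rel M d" and tu: "(t, u) \<in> cauchy_rel M d"
    have "(s, s) \<in> cauchy_rel M d"
      using st by (auto simp: cauchy_rel_def MCauchy_in_space)
    then have "(\<lambda>n. d (s n) (u n)) \<longlonglongrightarrow> 0"
      using mdist_lim_cong[OF _ tu, of s s 0] st by (simp add: cauchy_rel_def)
    then show "(s, u) \<in> cauchy_rel M d"
      using st tu by (auto simp: cauchy_rel_def)
  qed
qed

lemma class_in_completion: "MCauchy s \<Longrightarrow> cauchy_rel M d `` {s} \<in> completion M d"
  by (simp add: completion_def quotientI)

lemma self_in_class: "MCauchy s \<Longrightarrow> s \<in> cauchy_rel M d `` {s}"
  using equiv_class_self[OF equiv_cauchy_rel] by simp

lemma completion_MCauchy: "A \<in> completion M d \<Longrightarrow> s \<in> A \<Longrightarrow> MCauchy s"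
  by (auto simp: completion_def quotient_def cauchy_rel_def)

lemma completion_eq_class: "A \<in> completion M d \<Longrightarrow> s \<in> A \<Longrightarrow> A = cauchy_rel M d `` {s}"
  unfolding completion_def using equiv_class_eq[OF equiv_cauchy_rel] by (auto elim!: quotientE)

lemma completion_nonempty:
  assumes "A \<in> completion M d"
  obtains s where "s \<in> A"
  using assms equiv_cauchy_rel in_quotient_imp_non_empty unfolding completion_def by blast

lemma completion_rel:
  assumes "A \<in> completion M d" "s \<in> A" "s' \<in> A"
  shows "(s, s') \<in> cauchy_rel M d"
  using completion_eq_class[OF assms(1,2)] assms(3) by simp

text \<open>Resolves the definite description in \<open>completion_dist\<close>: the limit exists
  since the distances form a Cauchy sequence of reals, and it is the same for all representatives.
  Distances of classes are henceforth computed from one chosen pair.\<close>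

lemma completion_dist_lim:
  assumes A: "A \<in> completion M d" "s \<in> A" and B: "B \<in> completion M d" "t \<in> B"
  shows "(\<lambda>n. d (s n) (t n)) \<longlonglongrightarrow> completion_dist M d A B"
proof -
  obtain r where r: "(\<lambda>n. d (s n) (t n)) \<longlonglongrightarrow> r"
    using convergent_mdist completion_MCauchy A B unfolding convergent_def by blast
  have "(THE r. \<forall>s\<in>A. \<forall>t\<in>B. (\<lambda>n. d (s n) (t n)) \<longlonglongrightarrow> r) = r"
  proof (rule the_equality)
    show "\<forall>s\<in>A. \<forall>t\<in>B. (\<lambda>n. d (s n) (t n)) \<longlonglongrightarrow> r"
      using mdist_lim_cong[OF _ _ r] completion_rel A B by blast
    show "\<And>r'. \<forall>s\<in>A. \<forall>t\<in>B. (\<lambda>n. d (s n) (t n)) \<longlonglongrightarrow> r' \<Longrightarrow> r' = r"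
      using r A B LIMSEQ_unique by blast
  qed
  then show ?thesis
    using r A B by (simp add: completion_dist_def)
qed

lemma completion_dist_eqI:
  assumes "A \<in> completion M d" "s \<in> A" "B \<in> completion M d" "t \<in> B"
    and "(\<lambda>n. d (s n) (t n)) \<longlonglongrightarrow> r"
  shows "completion_dist M d A B = r"
  using completion_dist_lim[OF assms(1-4)] assms(5) LIMSEQ_unique by blast

lemma Metric_space_completion: "Metric_space (completion M d) (completion_dist M d)"
proof
  fix A B
  show "0 \<le> completion_dist M d A B"
  proof (cases "A \<in> completion M d \<and> B \<in> completion M d")
    case True
    then obtain s t where "s \<in> A" "t \<in> B"
      by (metis completion_nonempty)
    then show ?thesis
      using completion_dist_lim[of A s B t] True by (intro LIMSEQ_le_const) auto
  qed (auto simp: completion_dist_def)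
  show "completion_dist M d A B = completion_dist M d B A"
  proof (cases "A \<in> completion M d \<and> B \<in> completion M d")
    case True
    then obtain s t where "s \<in> A" "t \<in> B"
      by (metis completion_nonempty)
    then show ?thesis
      using completion_dist_lim[of A s B t] completion_dist_eqI[of B t A s] True
      by (simp add: commute)
  qed (auto simp: completion_dist_def)
next
  fix A B
  assume A: "A \<in> completion M d" and B: "B \<in> completion M d"
  obtain s t where s: "s \<in> A" and t: "t \<in> B"
    using A B by (metis completion_nonempty)
  show "completion_dist M d A B = 0 \<longleftrightarrow> A = B"
  proof
    assume "completion_dist M d A B = 0"
    then have "(s, t) \<in> cauchy_rel M d"
      using completion_dist_lim[OF A s B t] completion_MCauchy A B s t
      by (auto simp: cauchy_rel_def)
    then show "A = B"
      using completion_eq_class A B s t equiv_class_eq[OF equiv_cauchy_rel] by metis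
  next
    assume "A = B"
    then show "completion_dist M d A B = 0"
      using completion_dist_eqI[OF A s A s] completion_MCauchy[OF A s]
      by (simp add: MCauchy_in_space)
  qed
next
  fix A B C
  assume A: "A \<in> completion M d" and B: "B \<in> completion M d" and C: "C \<in> completion M d"
  obtain s t u where stu: "s \<in> A" "t \<in> B" "u \<in> C"
    using A B C by (metis completion_nonempty)
  then have "MCauchy s" "MCauchy t" "MCauchy u"
    using A B C completion_MCauchy by auto
  then have "d (s n) (u n) \<le> d (s n) (t n) + d (t n) (u n)" for n
    by (simp add: MCauchy_in_space triangle)
  then show "completion_dist M d A C \<le> completion_dist M d A B + completion_dist M d B C"
    using completion_dist_lim stu A B C
    by (intro LIMSEQ_le[OF completion_dist_lim tendsto_add[OF completion_dist_lim completion_dist_lim]])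
       auto
qed

lemma completion_dist_const:
  assumes "x \<in> M" "y \<in> M"
  shows "completion_dist M d (cauchy_rel M d `` {\<lambda>_. x}) (cauchy_rel M d `` {\<lambda>_. y}) = d x y"
  using assms
  by (intro completion_dist_eqI[of _ "\<lambda>_. x" _ "\<lambda>_. y"] class_in_completion self_in_class) auto

text \<open>Density: the constant classes of the members of a representing sequence converge to the
  class itself, because the tail of the sequence stays within e/2 of its n-th member.\<close>

lemma completion_dist_const_tendsto:
  assumes A: "A \<in> completion M d" "s \<in> A"
  shows "(\<lambda>n. completion_dist M d (cauchy_rel M d `` {\<lambda>_. s n}) A) \<longlonglongrightarrow> 0"
proof (rule LIMSEQ_I)
  interpret C: Metric_space "completion M d" "completion_dist M d"
    by (rule Metric_space_completion)
  fix e :: real assume "0 < e"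
  have s: "MCauchy s"
    using completion_MCauchy A by blast
  then obtain N where N: "\<forall>n n'. N \<le> n \<longrightarrow> N \<le> n' \<longrightarrow> d (s n) (s n') < e/2"
    using \<open>0 < e\<close> unfolding MCauchy_def by (meson half_gt_zero)
  have "completion_dist M d (cauchy_rel M d `` {\<lambda>_. s n}) A \<le> e/2" if "n \<ge> N" for n
  proof (rule LIMSEQ_le_const2)
    show "(\<lambda>k. d (s n) (s k)) \<longlonglongrightarrow> completion_dist M d (cauchy_rel M d `` {\<lambda>_. s n}) A"
      using s A
      by (intro completion_dist_lim class_in_completion self_in_class)
         (auto simp: MCauchy_in_space)
    show "\<exists>N. \<forall>k\<ge>N. d (s n) (s k) \<le> e/2"
      using N that by (meson less_imp_le)
  qed
  then show "\<exists>N. \<forall>n\<ge>N. norm (completion_dist M d (cauchy_rel M d `` {\<lambda>_. s n}) A - 0) < e"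
    using \<open>0 < e\<close> by (intro exI[of _ N]) fastforce
qed

text \<open>By density each \<open>A n\<close> is approximated within 1/(n+1) by the constant class
  of a point \<open>x n\<close>. The points form a Cauchy sequence by two detours through
  \<open>A n\<close> and \<open>A n'\<close>, hence the thirds of e, and the class of
  \<open>x\<close> is the limit.\<close>

lemma mcomplete_completion: "Metric_space.mcomplete (completion M d) (completion_dist M d)"
proof -
  interpret C: Metric_space "completion M d" "completion_dist M d"
    by (rule Metric_space_completion)
  let ?c = "\<lambda>x. cauchy_rel M d `` {\<lambda>_. x}"
  let ?D = "completion_dist M d"
  have c: "?c x \<in> completion M d" if "x \<in> M" for x
    using that by (simp add: class_in_completion)
  have "\<exists>L. limitin C.mtopology A L sequentially" if A: "C.MCauchy A" for A
  proof -
    have AM: "A n \<in> completion M d" for n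
      using A by (rule C.MCauchy_in_space)
    have "\<exists>x. x \<in> M \<and> ?D (?c x) (A n) < 1 / real (Suc n)" for n
    proof -
      obtain s where s: "s \<in> A n"
        using AM completion_nonempty by blast
      have "eventually (\<lambda>k. ?D (?c (s k)) (A n) < 1 / real (Suc n)) sequentially"
        using completion_dist_const_tendsto[OF AM s] by (intro order_tendstoD(2)) auto
      then obtain k where "?D (?c (s k)) (A n) < 1 / real (Suc n)"
        by (auto simp: eventually_sequentially)
      then show ?thesis
        using completion_MCauchy[OF AM s] MCauchy_in_space by blast
    qed
    then obtain x where xM: "\<And>n. x n \<in> M" and x: "\<And>n. ?D (?c (x n)) (A n) < 1 / real (Suc n)"
      by metis
    have null: "(\<lambda>n. ?D (?c (x n)) (A n)) \<longlonglongrightarrow> 0"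
      by (rule tendsto_sandwich[OF _ _ tendsto_const LIMSEQ_inverse_real_of_nat])
         (use x in \<open>auto simp: inverse_eq_divide less_imp_le\<close>)
    have "MCauchy x"
      unfolding MCauchy_def
    proof (intro conjI allI impI)
      show "range x \<subseteq> M" using xM by auto
      fix e :: real assume "0 < e"
      then obtain N where N: "\<forall>n n'. N \<le> n \<longrightarrow> N \<le> n' \<longrightarrow> ?D (A n) (A n') < e/3"
        using A unfolding C.MCauchy_def by (meson divide_pos_pos zero_less_numeral)
      obtain K where K: "\<And>n. n \<ge> K \<Longrightarrow> ?D (?c (x n)) (A n) < e/3"
        using order_tendstoD(2)[OF null, of "e/3"] \<open>0 < e\<close> by (auto simp: eventually_sequentially)
      have "d (x n) (x n') < e" if "n \<ge> max N K" "n' \<ge> max N K" for n n'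
      proof -
        have "d (x n) (x n') = ?D (?c (x n)) (?c (x n'))"
          by (simp add: completion_dist_const xM)
        also have "\<dots> \<le> ?D (?c (x n)) (A n) + (?D (A n) (A n') + ?D (A n') (?c (x n')))"
          using C.triangle[of "?c (x n)" "A n" "?c (x n')"] C.triangle[of "A n" "A n'" "?c (x n')"]
          by (simp add: c xM AM)
        also have "\<dots> < e"
        proof -
          have "?D (A n) (A n') < e/3" "?D (?c (x n)) (A n) < e/3" "?D (?c (x n')) (A n') < e/3"
            using N K that by auto
          then show ?thesis
            by (simp add: C.commute[of "A n'"])
        qed
        finally show ?thesis .
      qed
      then show "\<exists>N. \<forall>n n'. N \<le> n \<longrightarrow> N \<le> n' \<longrightarrow> d (x n) (x n') < e"
        by blast
    qed
    let ?L = "cauchy_rel M d `` {x}"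
    have L: "?L \<in> completion M d" "x \<in> ?L"
      using \<open>MCauchy x\<close> class_in_completion self_in_class by auto
    have "(\<lambda>n. ?D (?c (x n)) (A n) + ?D (?c (x n)) ?L) \<longlonglongrightarrow> 0"
      using tendsto_add[OF null completion_dist_const_tendsto[OF L]] by simp
    then have "(\<lambda>n. ?D (A n) ?L) \<longlonglongrightarrow> 0"
      by (rule Lim_null_comparison[rotated])
         (simp add: C.triangle'' c xM AM L)
    then show ?thesis
      using L AM by (auto simp: C.limitin_metric_dist_null)
  qed
  then show ?thesis
    by (simp add: C.mcomplete_def)
qed

end

section \<open>Limits and continuous maps into a metric space\<close>

lemma (in Metric_space) limitin_cong_dist:
  assumes lim: "limitin mtopology f l sequentially" and g: "\<And>n. g n \<in> M"
    and z: "(\<lambda>n. d (f n) (g n)) \<longlonglongrightarrow> 0"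
  shows "limitin mtopology g l sequentially"
proof -
  have l: "l \<in> M" and f: "\<forall>\<^sub>F n in sequentially. f n \<in> M" and fl: "(\<lambda>n. d (f n) l) \<longlonglongrightarrow> 0"
    using lim by (auto simp: limitin_metric_dist_null)
  have "\<forall>\<^sub>F n in sequentially. norm (d (g n) l) \<le> d (f n) (g n) + d (f n) l"
    using f by (rule eventually_mono) (use g l triangle'' in auto)
  moreover have "(\<lambda>n. d (f n) (g n) + d (f n) l) \<longlonglongrightarrow> 0"
    using tendsto_add[OF z fl] by simp
  ultimately have "(\<lambda>n. d (g n) l) \<longlonglongrightarrow> 0"
    by (rule Lim_null_comparison)
  then show ?thesis
    using l g by (simp add: limitin_metric_dist_null)
qed

text \<open>In this form continuity mentions the codomain only through membership and distances
  between values of f, which is exactly what an isometry preserves and reflects.\<close>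

lemma (in Metric_space) continuous_map_into_mtopology_iff:
  "continuous_map X mtopology f \<longleftrightarrow>
     (\<forall>x\<in>topspace X. f x \<in> M \<and>
        (\<forall>e>0. \<exists>U. openin X U \<and> x \<in> U \<and> (\<forall>y\<in>U. d (f x) (f y) < e)))"
  (is "?L \<longleftrightarrow> ?R")
proof
  assume L: ?L
  show ?R
  proof (intro ballI conjI allI impI)
    fix x assume x: "x \<in> topspace X"
    then show fx: "f x \<in> M"
      using L by (auto simp: continuous_map_def)
    fix e :: real assume "0 < e"
    then show "\<exists>U. openin X U \<and> x \<in> U \<and> (\<forall>y\<in>U. d (f x) (f y) < e)"
      using openin_continuous_map_preimage[OF L openin_mball[of "f x" e]] x fx
      by (intro exI[of _ "{y \<in> topspace X. f y \<in> mball (f x) e}"]) auto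
  qed
next
  assume R: ?R
  show ?L
    unfolding continuous_map_def
  proof (intro conjI allI impI)
    show "f \<in> topspace X \<rightarrow> topspace mtopology"
      using R by auto
    fix V assume V: "openin mtopology V"
    show "openin X {x \<in> topspace X. f x \<in> V}"
    proof (subst openin_subopen, intro ballI)
      fix x assume x: "x \<in> {x \<in> topspace X. f x \<in> V}"
      then obtain e where "0 < e" and e: "mball (f x) e \<subseteq> V"
        using V unfolding openin_mtopology by blast
      moreover have "\<forall>e>0. \<exists>U. openin X U \<and> x \<in> U \<and> (\<forall>y\<in>U. d (f x) (f y) < e)"
        using R x by simp
      ultimately obtain U where U: "openin X U" "x \<in> U" "\<forall>y\<in>U. d (f x) (f y) < e"
        by metis
      have "U \<subseteq> topspace X"
        using U(1) by (rule openin_subset)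
      then have "U \<subseteq> {x \<in> topspace X. f x \<in> V}"
        using U R x e by (auto simp: subset_iff)
      then show "\<exists>T. openin X T \<and> x \<in> T \<and> T \<subseteq> {x \<in> topspace X. f x \<in> V}"
        using U by blast
    qed
  qed
qed

section \<open>Ultra-metric maps\<close>

lemma umm_range: "umm n f \<Longrightarrow> x \<in> cube n \<Longrightarrow> 0 \<le> f x \<and> f x \<le> 1"
  by (auto simp: umm_def Pi_iff)

lemma umm_eq_0_iff: "umm n f \<Longrightarrow> x \<in> cube n \<Longrightarrow> f x = 0 \<longleftrightarrow> (\<forall>i<n. x i = 0)"
  by (auto simp: umm_def)

lemma umm_max:
  "umm n f \<Longrightarrow> x \<in> cube n \<Longrightarrow> y \<in> cube n \<Longrightarrow> f (\<lambda>i\<in>{..<n}. max (x i) (y i)) = max (f x) (f y)"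
  by (auto simp: umm_def)

text \<open>If x lies below y componentwise, their componentwise maximum is y, so distributivity
  gives max (f x) (f y) = f y.\<close>

lemma umm_mono:
  assumes "umm n f" and x: "x \<in> cube n" and y: "y \<in> cube n" and le: "\<And>i. i < n \<Longrightarrow> x i \<le> y i"
  shows "f x \<le> f y"
proof -
  have "(\<lambda>i\<in>{..<n}. max (x i) (y i)) = y"
    using y le by (auto simp: fun_eq_iff PiE_iff extensional_def)
  then show ?thesis
    using umm_max[OF assms(1) x y] by simp
qed

text \<open>Used to push the strong triangle inequality from the arguments of a symbol to the whole
  term.\<close>

lemma umm_le_max:
  assumes "umm n f" and xyz: "x \<in> cube n" "y \<in> cube n" "z \<in> cube n"
    and le: "\<And>i. i < n \<Longrightarrow> x i \<le> max (y i) (z i)"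
  shows "f x \<le> max (f y) (f z)"
proof -
  have "(\<lambda>i\<in>{..<n}. max (y i) (z i)) \<in> cube n"
    using xyz by (auto simp: PiE_iff le_max_iff_disj)
  then show ?thesis
    using umm_mono[OF assms(1) xyz(1), of "\<lambda>i\<in>{..<n}. max (y i) (z i)"] le umm_max[OF assms(1) xyz(2,3)]
    by simp
qed

lemma continuous_umm_tendsto:
  assumes f: "continuous_umm n f" and X: "\<And>k. X k \<in> cube n" and x: "x \<in> cube n"
    and lim: "\<And>i. i < n \<Longrightarrow> (\<lambda>k. X k i) \<longlonglongrightarrow> x i"
  shows "(\<lambda>k. f (X k)) \<longlonglongrightarrow> f x"
proof -
  have "limitin (product_topology (\<lambda>_. top_of_set {0..1}) {..<n}) X x sequentially"
    unfolding limitin_componentwise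
  proof (intro conjI ballI)
    show "x \<in> extensional {..<n}"
      using x by (simp add: PiE_iff)
    show "\<forall>\<^sub>F k in sequentially.
        X k \<in> topspace (product_topology (\<lambda>_. top_of_set {0..1}) {..<n})"
      using X by simp
    show "limitin (top_of_set {0..1}) (\<lambda>k. X k i) (x i) sequentially" if "i \<in> {..<n}" for i
      using that lim X x by (auto simp: limitin_subtopology PiE_iff)
  qed
  then have "limitin (top_of_set {0..1}) (f \<circ> X) (f x) sequentially"
    using continuous_map_limit f by (auto simp only: continuous_umm_def)
  then show ?thesis
    by (simp add: limitin_subtopology o_def)
qed

text \<open>Continuity at the zero tuple, with one bound for all coordinates. Monotonicity reduces
  the box below 1/(k+1) to its upper corner, so only the diagonal sequence of these corners has to
  be examined.\<close>

lemma continuous_umm_small: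
  assumes f: "continuous_umm n f" and "0 < e"
  obtains \<delta> where "0 < \<delta>" "\<And>x. x \<in> cube n \<Longrightarrow> (\<And>i. i < n \<Longrightarrow> x i < \<delta>) \<Longrightarrow> f x < e"
proof -
  let ?X = "\<lambda>k. \<lambda>i\<in>{..<n}. inverse (real (Suc k))"
  let ?z = "\<lambda>i\<in>{..<n}. 0 :: real"
  have umm: "umm n f"
    using f by (simp add: continuous_umm_def)
  have X: "?X k \<in> cube n" for k
    by (auto simp: inverse_le_1_iff)
  have z: "?z \<in> cube n"
    by auto
  have "(\<lambda>k. f (?X k)) \<longlonglongrightarrow> f ?z"
    using continuous_umm_tendsto[OF f X z] LIMSEQ_inverse_real_of_nat by simp
  moreover have "f ?z = 0"
    using umm_eq_0_iff[OF umm z] by simp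
  ultimately have "\<forall>\<^sub>F k in sequentially. f (?X k) < e"
    using order_tendstoD(2) \<open>0 < e\<close> by metis
  then obtain k where k: "f (?X k) < e"
    by (auto simp: eventually_sequentially)
  show thesis
  proof (rule that[of "inverse (real (Suc k))"])
    fix x assume x: "x \<in> cube n" and lt: "\<And>i. i < n \<Longrightarrow> x i < inverse (real (Suc k))"
    have "f x \<le> f (?X k)"
      using umm_mono[OF umm x X] lt by (simp add: less_imp_le)
    then show "f x < e"
      using k by simp
  qed simp
qed

section \<open>Finite terms\<close>

lemma fin_terms_Fun_iff:
  "Fun F ts \<in> fin_terms \<Sigma> \<longleftrightarrow>
     F \<in> symbols \<Sigma> \<and> length ts = arity \<Sigma> F \<and> (\<forall>t\<in>set ts. t \<in> fin_terms \<Sigma>)"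
  by (auto intro: fin_terms.Fun elim: fin_terms.cases)

text \<open>Folds the conditional back into \<open>restrict\<close>, so that argument tuples are
  visibly members of a cube; it takes over from the defining equation, which leaves the simpset
  below.\<close>

lemma pre_dist_Fun:
  "pre_dist m (Fun F ts) (Fun G us) =
     (if F = G then m F (\<lambda>i\<in>{..<length ts}. pre_dist m (ts ! i) (us ! i)) else 1)"
  by (simp add: restrict_def)

declare pre_dist.simps(2) [simp del]

locale metric_sig =
  fixes \<Sigma> :: "'f msig"
  assumes term_metric: "term_metric \<Sigma>"
begin

lemma umap_continuous: "F \<in> symbols \<Sigma> \<Longrightarrow> continuous_umm (arity \<Sigma> F) (umap \<Sigma> F)"
  using term_metric by (simp add: term_metric_def)

lemma umap_umm: "F \<in> symbols \<Sigma> \<Longrightarrow> umm (arity \<Sigma> F) (umap \<Sigma> F)"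
  using umap_continuous by (simp add: continuous_umm_def)

lemma pre_dist_range:
  fixes t u :: "('f, 'v) fterm"
  assumes "t \<in> fin_terms \<Sigma>" "u \<in> fin_terms \<Sigma>"
  shows "pre_dist (umap \<Sigma>) t u \<in> {0..1}"
  using assms
proof (induction t arbitrary: u rule: fterm.induct)
  case (Var x)
  then show ?case by (cases u) auto
next
  case (Fun F ts)
  show ?case
  proof (cases u)
    case (Fun G us)
    show ?thesis
    proof (cases "F = G")
      case True
      have "(\<lambda>i\<in>{..<length ts}. pre_dist (umap \<Sigma>) (ts ! i) (us ! i)) \<in> cube (arity \<Sigma> F)"
        using Fun.IH Fun.prems Fun True by (auto simp: fin_terms_Fun_iff)
      then show ?thesis
        using True Fun Fun.prems umm_range[OF umap_umm] by (auto simp: pre_dist_Fun fin_terms_Fun_iff)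
    qed (simp add: Fun pre_dist_Fun)
  qed simp
qed

lemma pre_dist_args_cube:
  assumes "Fun F ts \<in> fin_terms \<Sigma>" "Fun F us \<in> fin_terms \<Sigma>"
  shows "(\<lambda>i\<in>{..<length ts}. pre_dist (umap \<Sigma>) (ts ! i) (us ! i)) \<in> cube (arity \<Sigma> F)"
  using assms pre_dist_range[of "ts ! i" "us ! i" for i]
  by (auto simp: fin_terms_Fun_iff simp del: atLeastAtMost_iff)

lemma pre_dist_commute:
  fixes t u :: "('f, 'v) fterm"
  assumes "t \<in> fin_terms \<Sigma>" "u \<in> fin_terms \<Sigma>"
  shows "pre_dist (umap \<Sigma>) t u = pre_dist (umap \<Sigma>) u t"
  using assms
proof (induction t arbitrary: u rule: fterm.induct)
  case (Var x)
  then show ?case by (cases u) auto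
next
  case (Fun F ts)
  show ?case
  proof (cases u)
    case (Fun G us)
    show ?thesis
    proof (cases "F = G")
      case True
      then have "(\<lambda>i\<in>{..<length ts}. pre_dist (umap \<Sigma>) (ts ! i) (us ! i)) =
                 (\<lambda>i\<in>{..<length us}. pre_dist (umap \<Sigma>) (us ! i) (ts ! i))"
        using Fun.IH[OF nth_mem] Fun.prems Fun by (auto simp: fin_terms_Fun_iff fun_eq_iff)
      then show ?thesis
        using True Fun by (simp add: pre_dist_Fun)
    qed (simp add: Fun pre_dist_Fun)
  qed simp
qed

lemma pre_dist_eq_0_iff:
  fixes t u :: "('f, 'v) fterm"
  assumes "t \<in> fin_terms \<Sigma>" "u \<in> fin_terms \<Sigma>"
  shows "pre_dist (umap \<Sigma>) t u = 0 \<longleftrightarrow> t = u"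
  using assms
proof (induction t arbitrary: u rule: fterm.induct)
  case (Var x)
  then show ?case by (cases u) auto
next
  case (Fun F ts)
  show ?case
  proof (cases u)
    case (Fun G us)
    show ?thesis
    proof (cases "F = G")
      case True
      have "pre_dist (umap \<Sigma>) (Fun F ts) u = 0 \<longleftrightarrow>
            (\<forall>i<length ts. pre_dist (umap \<Sigma>) (ts ! i) (us ! i) = 0)"
        using True Fun Fun.prems umm_eq_0_iff[OF umap_umm pre_dist_args_cube, of F ts us]
        by (auto simp: pre_dist_Fun fin_terms_Fun_iff)
      also have "\<dots> \<longleftrightarrow> (\<forall>i<length ts. ts ! i = us ! i)"
        using Fun.IH Fun.prems True Fun by (auto simp: fin_terms_Fun_iff)
      also have "\<dots> \<longleftrightarrow> Fun F ts = u"
        using Fun.prems True Fun by (auto simp: fin_terms_Fun_iff list_eq_iff_nth_eq)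
      finally show ?thesis .
    qed (simp add: Fun pre_dist_Fun)
  qed simp
qed

text \<open>The ultrametric form is proved because the induction carries it:
  \<open>umm_le_max\<close> lifts it from arguments to terms with a common root symbol.\<close>

lemma pre_dist_ultra:
  fixes t u v :: "('f, 'v) fterm"
  assumes "t \<in> fin_terms \<Sigma>" "u \<in> fin_terms \<Sigma>" "v \<in> fin_terms \<Sigma>"
  shows "pre_dist (umap \<Sigma>) t v \<le> max (pre_dist (umap \<Sigma>) t u) (pre_dist (umap \<Sigma>) u v)"
  using assms
proof (induction t arbitrary: u v rule: fterm.induct)
  case (Var x)
  then show ?case by (cases u; cases v) auto
next
  case (Fun F ts)
  note IH = Fun.IH and prems = Fun.prems
  have le1: "pre_dist (umap \<Sigma>) (Fun F ts) v \<le> 1"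
    using pre_dist_range prems by fastforce
  show ?case
  proof (cases "\<exists>us vs. u = Fun F us \<and> v = Fun F vs")
    case True
    then obtain us vs where uv: "u = Fun F us" "v = Fun F vs"
      by blast
    have len: "F \<in> symbols \<Sigma>" "length ts = arity \<Sigma> F" "length us = arity \<Sigma> F" "length vs = arity \<Sigma> F"
      using prems uv by (auto simp: fin_terms_Fun_iff)
    have "umap \<Sigma> F (\<lambda>i\<in>{..<length ts}. pre_dist (umap \<Sigma>) (ts ! i) (vs ! i))
        \<le> max (umap \<Sigma> F (\<lambda>i\<in>{..<length ts}. pre_dist (umap \<Sigma>) (ts ! i) (us ! i)))
              (umap \<Sigma> F (\<lambda>i\<in>{..<length us}. pre_dist (umap \<Sigma>) (us ! i) (vs ! i)))"
      using IH prems uv len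
      by (intro umm_le_max[OF umap_umm] pre_dist_args_cube) (auto simp: fin_terms_Fun_iff)
    then show ?thesis
      using uv by (simp add: pre_dist_Fun)
  next
    case False
    \<comment> \<open>Unless all three terms have root F, the root changes between t and u or
      between u and v, and one distance on the right is already maximal.\<close>
    then have "pre_dist (umap \<Sigma>) (Fun F ts) u = 1 \<or> pre_dist (umap \<Sigma>) u v = 1"
      by (cases u; cases v) (auto simp: pre_dist_Fun)
    then show ?thesis
      using le1 by auto
  qed
qed

lemma Metric_space_fin: "Metric_space (fin_terms \<Sigma> :: ('f, 'v) fterm set) (fin_dist \<Sigma>)"
proof
  fix t u v :: "('f, 'v) fterm"
  show "0 \<le> fin_dist \<Sigma> t u"
    using pre_dist_range by (fastforce simp: fin_dist_def)
  show "fin_dist \<Sigma> t u = fin_dist \<Sigma> u t"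
    by (auto simp: fin_dist_def pre_dist_commute)
  assume t: "t \<in> fin_terms \<Sigma>" and u: "u \<in> fin_terms \<Sigma>"
  then show "fin_dist \<Sigma> t u = 0 \<longleftrightarrow> t = u"
    by (simp add: fin_dist_def pre_dist_eq_0_iff)
  assume v: "v \<in> fin_terms \<Sigma>"
  have "0 \<le> pre_dist (umap \<Sigma>) t u" "0 \<le> pre_dist (umap \<Sigma>) u v"
    using pre_dist_range t u v by fastforce+
  then show "fin_dist \<Sigma> t v \<le> fin_dist \<Sigma> t u + fin_dist \<Sigma> u v"
    using pre_dist_ultra[OF t u v] t u v by (simp add: fin_dist_def)
qed

end

section \<open>The space of terms\<close>

context metric_sig
begin

abbreviation fin_cauchy :: "(nat \<Rightarrow> ('f, 'v) fterm) \<Rightarrow> bool" where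
  "fin_cauchy \<equiv> Metric_space.MCauchy (fin_terms \<Sigma>) (fin_dist \<Sigma>)"

text \<open>The type of variables is no parameter of the locale; instantiating the metric facts one
  by one keeps it polymorphic.\<close>

lemmas fin_cauchy_def = Metric_space.MCauchy_def[OF Metric_space_fin]
lemmas fin_cauchy_const = Metric_space.MCauchy_const[OF Metric_space_fin]
lemmas fin_cauchy_in = Metric_space.MCauchy_in_space[OF Metric_space_fin]
lemmas class_in_Ter = Metric_space.class_in_completion[OF Metric_space_fin, folded Ter_def]
lemmas in_class = Metric_space.self_in_class[OF Metric_space_fin]
lemmas Ter_cauchy = Metric_space.completion_MCauchy[OF Metric_space_fin, folded Ter_def]
lemmas Ter_nonempty = Metric_space.completion_nonempty[OF Metric_space_fin, folded Ter_def]
lemmas Ter_rel = Metric_space.completion_rel[OF Metric_space_fin, folded Ter_def]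
lemmas equiv_ter_rel = Metric_space.equiv_cauchy_rel[OF Metric_space_fin]
lemmas ter_dist_lim =
  Metric_space.completion_dist_lim[OF Metric_space_fin, folded Ter_def ter_dist_def]
lemmas ter_dist_eqI =
  Metric_space.completion_dist_eqI[OF Metric_space_fin, folded Ter_def ter_dist_def]
lemmas Metric_space_Ter =
  Metric_space.Metric_space_completion[OF Metric_space_fin, folded Ter_def ter_dist_def]
lemmas mcomplete_Ter =
  Metric_space.mcomplete_completion[OF Metric_space_fin, folded Ter_def ter_dist_def]
lemmas ter_dist_refl = Metric_space.mdist_zero[OF Metric_space_Ter]
lemmas ter_limit_iff =
  Metric_space.limitin_metric_dist_null[OF Metric_space_Ter, folded ter_topology_def]
lemmas ter_limit_unique =
  Metric_space.limitin_metric_unique[OF Metric_space_Ter, folded ter_topology_def]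
lemmas ter_limit_cong =
  Metric_space.limitin_cong_dist[OF Metric_space_Ter, folded ter_topology_def]

lemma fin_dist_range: "fin_dist \<Sigma> t u \<in> {0..1}"
  using pre_dist_range by (auto simp: fin_dist_def)

lemma ter_dist_range:
  assumes "c \<in> Ter \<Sigma>" "c' \<in> Ter \<Sigma>"
  shows "ter_dist \<Sigma> c c' \<in> {0..1}"
proof -
  obtain s t where "s \<in> c" "t \<in> c'"
    using assms by (metis Ter_nonempty)
  then have "(\<lambda>n. fin_dist \<Sigma> (s n) (t n)) \<longlonglongrightarrow> ter_dist \<Sigma> c c'"
    using assms ter_dist_lim by blast
  then show ?thesis
    by (rule closed_sequentially[OF closed_atLeastAtMost, rotated]) (rule fin_dist_range)
qed

lemma fin_dist_Fun:
  assumes "Fun F ts \<in> fin_terms \<Sigma>" "Fun F us \<in> fin_terms \<Sigma>"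
  shows "fin_dist \<Sigma> (Fun F ts) (Fun F us) =
         umap \<Sigma> F (\<lambda>i\<in>{..<arity \<Sigma> F}. fin_dist \<Sigma> (ts ! i) (us ! i))"
proof -
  have "(\<lambda>i\<in>{..<length ts}. pre_dist (umap \<Sigma>) (ts ! i) (us ! i)) =
        (\<lambda>i\<in>{..<arity \<Sigma> F}. fin_dist \<Sigma> (ts ! i) (us ! i))"
    using assms by (auto simp: fun_eq_iff fin_dist_def fin_terms_Fun_iff)
  then show ?thesis
    using assms by (simp add: fin_dist_def pre_dist_Fun)
qed

section \<open>Application of function symbols on the completion\<close>

lemma Fun_seq_in_fin_terms:
  assumes "F \<in> symbols \<Sigma>" "length ss = arity \<Sigma> F" "\<forall>s\<in>set ss. fin_cauchy s"
  shows "Fun F (map (\<lambda>s. s k) ss) \<in> fin_terms \<Sigma>"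
  using assms by (auto simp: fin_terms_Fun_iff fin_cauchy_in)

text \<open>Distances between members of the new sequence are \<open>umap\<close> of tuples of
  argument distances, so smallness of \<open>umap\<close> near the zero tuple suffices.\<close>

lemma fin_cauchy_Fun:
  assumes F: "F \<in> symbols \<Sigma>" "length ss = arity \<Sigma> F" and ss: "\<forall>s\<in>set ss. fin_cauchy s"
  shows "fin_cauchy (\<lambda>k. Fun F (map (\<lambda>s. s k) ss))"
  unfolding fin_cauchy_def
proof (intro conjI allI impI)
  show "range (\<lambda>k. Fun F (map (\<lambda>s. s k) ss)) \<subseteq> fin_terms \<Sigma>"
    using Fun_seq_in_fin_terms[OF assms] by auto
  fix e :: real assume "0 < e"
  then obtain \<delta> where "0 < \<delta>" and
    \<delta>: "\<And>x. x \<in> cube (arity \<Sigma> F) \<Longrightarrow> (\<And>i. i < arity \<Sigma> F \<Longrightarrow> x i < \<delta>) \<Longrightarrow> umap \<Sigma> F x < e"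
    using continuous_umm_small[OF umap_continuous[OF F(1)]] by metis
  have "\<forall>s\<in>set ss. \<exists>N. \<forall>n n'. N \<le> n \<longrightarrow> N \<le> n' \<longrightarrow> fin_dist \<Sigma> (s n) (s n') < \<delta>"
    using ss \<open>0 < \<delta>\<close> by (simp add: fin_cauchy_def)
  then obtain N where
    N: "\<forall>s\<in>set ss. \<forall>n n'. N s \<le> n \<longrightarrow> N s \<le> n' \<longrightarrow> fin_dist \<Sigma> (s n) (s n') < \<delta>"
    by (rule bchoice[THEN exE])
  \<comment> \<open>For a nullary symbol this is \<open>Max {}\<close>, some unspecified number, and
    there is no argument to control.\<close>
  let ?N = "Max (N ` set ss)"
  have "fin_dist \<Sigma> (Fun F (map (\<lambda>s. s n) ss)) (Fun F (map (\<lambda>s. s n') ss)) < e"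
    if "?N \<le> n" "?N \<le> n'" for n n'
  proof -
    have "fin_dist \<Sigma> ((ss ! i) n) ((ss ! i) n') < \<delta>" if "i < arity \<Sigma> F" for i
    proof -
      have "ss ! i \<in> set ss"
        using that F by simp
      moreover from this have "N (ss ! i) \<le> ?N"
        by (intro Max_ge) auto
      ultimately show ?thesis
        using N \<open>?N \<le> n\<close> \<open>?N \<le> n'\<close> le_trans by blast
    qed
    then have "umap \<Sigma> F (\<lambda>i\<in>{..<arity \<Sigma> F}. fin_dist \<Sigma>
        (map (\<lambda>s. s n) ss ! i) (map (\<lambda>s. s n') ss ! i)) < e"
      using F fin_dist_range by (intro \<delta>) (auto simp del: atLeastAtMost_iff)
    then show ?thesis
      by (simp add: fin_dist_Fun[OF Fun_seq_in_fin_terms[OF assms] Fun_seq_in_fin_terms[OF assms]])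
  qed
  then show "\<exists>N. \<forall>n n'. N \<le> n \<longrightarrow> N \<le> n' \<longrightarrow>
      fin_dist \<Sigma> (Fun F (map (\<lambda>s. s n) ss)) (Fun F (map (\<lambda>s. s n') ss)) < e"
    by blast
qed

lemma Ter_args_cauchy:
  assumes "set cs \<subseteq> Ter \<Sigma>" "list_all2 (\<in>) ss cs"
  shows "\<forall>s\<in>set ss. fin_cauchy s"
proof
  fix s assume "s \<in> set ss"
  then obtain i where i: "i < length ss" "s = ss ! i"
    by (auto simp: in_set_conv_nth)
  then have "s \<in> cs ! i" "cs ! i \<in> Ter \<Sigma>"
    using assms by (auto simp: list_all2_conv_all_nth)
  then show "fin_cauchy s"
    by (rule Ter_cauchy[rotated])
qed

text \<open>Continuity of \<open>umap\<close> passes the limit through the symbol. With ds = cs this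
  shows that \<open>ter_app\<close> depends on no choice of representatives; in general it gives the
  distance formula \<open>ter_dist_app\<close>.\<close>

lemma fin_dist_Fun_lim:
  assumes F: "F \<in> symbols \<Sigma>"
    and cs: "length cs = arity \<Sigma> F" "set cs \<subseteq> Ter \<Sigma>" "list_all2 (\<in>) ss cs"
    and ds: "length ds = arity \<Sigma> F" "set ds \<subseteq> Ter \<Sigma>" "list_all2 (\<in>) ts ds"
  shows "(\<lambda>k. fin_dist \<Sigma> (Fun F (map (\<lambda>s. s k) ss)) (Fun F (map (\<lambda>s. s k) ts)))
         \<longlonglongrightarrow> umap \<Sigma> F (\<lambda>i\<in>{..<arity \<Sigma> F}. ter_dist \<Sigma> (cs ! i) (ds ! i))"
proof -
  have len: "length ss = arity \<Sigma> F" "length ts = arity \<Sigma> F"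
    using cs ds by (auto dest: list_all2_lengthD)
  have *: "(\<lambda>k. umap \<Sigma> F (\<lambda>i\<in>{..<arity \<Sigma> F}. fin_dist \<Sigma> ((ss ! i) k) ((ts ! i) k)))
         \<longlonglongrightarrow> umap \<Sigma> F (\<lambda>i\<in>{..<arity \<Sigma> F}. ter_dist \<Sigma> (cs ! i) (ds ! i))"
  proof (rule continuous_umm_tendsto[OF umap_continuous[OF F]])
    show "(\<lambda>i\<in>{..<arity \<Sigma> F}. fin_dist \<Sigma> ((ss ! i) k) ((ts ! i) k)) \<in> cube (arity \<Sigma> F)" for k
      using fin_dist_range by (auto simp del: atLeastAtMost_iff)
    have "ter_dist \<Sigma> (cs ! i) (ds ! i) \<in> {0..1}" if "i < arity \<Sigma> F" for i
      using that cs ds by (intro ter_dist_range) auto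
    then show "(\<lambda>i\<in>{..<arity \<Sigma> F}. ter_dist \<Sigma> (cs ! i) (ds ! i)) \<in> cube (arity \<Sigma> F)"
      by (auto simp del: atLeastAtMost_iff)
    show "(\<lambda>k. (\<lambda>i\<in>{..<arity \<Sigma> F}. fin_dist \<Sigma> ((ss ! i) k) ((ts ! i) k)) i)
        \<longlonglongrightarrow> (\<lambda>i\<in>{..<arity \<Sigma> F}. ter_dist \<Sigma> (cs ! i) (ds ! i)) i" if "i < arity \<Sigma> F" for i
    proof -
      have "(\<lambda>k. fin_dist \<Sigma> ((ss ! i) k) ((ts ! i) k)) \<longlonglongrightarrow> ter_dist \<Sigma> (cs ! i) (ds ! i)"
        using that cs ds by (intro ter_dist_lim) (auto simp: list_all2_conv_all_nth subsetD)
      then show ?thesis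
        using that by simp
    qed
  qed
  have "umap \<Sigma> F (\<lambda>i\<in>{..<arity \<Sigma> F}. fin_dist \<Sigma> ((ss ! i) k) ((ts ! i) k)) =
        fin_dist \<Sigma> (Fun F (map (\<lambda>s. s k) ss)) (Fun F (map (\<lambda>s. s k) ts))" for k
  proof -
    have "(\<lambda>i\<in>{..<arity \<Sigma> F}. fin_dist \<Sigma> ((ss ! i) k) ((ts ! i) k)) =
          (\<lambda>i\<in>{..<arity \<Sigma> F}. fin_dist \<Sigma> (map (\<lambda>s. s k) ss ! i) (map (\<lambda>s. s k) ts ! i))"
      using len by (auto simp: fun_eq_iff)
    then show ?thesis
      using Fun_seq_in_fin_terms[OF F len(1) Ter_args_cauchy[OF cs(2,3)]]
        Fun_seq_in_fin_terms[OF F len(2) Ter_args_cauchy[OF ds(2,3)]]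
      by (simp add: fin_dist_Fun)
  qed
  then show ?thesis
    using * by simp
qed

lemma ter_app_eq_class:
  assumes F: "F \<in> symbols \<Sigma>"
    and cs: "length cs = arity \<Sigma> F" "set cs \<subseteq> Ter \<Sigma>" "list_all2 (\<in>) ss cs"
  shows "ter_app \<Sigma> F cs = ter_rel \<Sigma> `` {\<lambda>k. Fun F (map (\<lambda>s. s k) ss)}"
proof -
  let ?seq = "\<lambda>ss k. Fun F (map (\<lambda>s. s k) ss)"
  have cau: "fin_cauchy (?seq ts)" if "list_all2 (\<in>) ts cs" for ts
    using that F cs Ter_args_cauchy by (intro fin_cauchy_Fun) (auto dest: list_all2_lengthD)
  \<comment> \<open>For two choices of representatives of the same arguments, the limit distance is
    \<open>umap\<close> at this tuple of self-distances, hence 0.\<close>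
  have z: "(\<lambda>i\<in>{..<arity \<Sigma> F}. ter_dist \<Sigma> (cs ! i) (cs ! i)) = (\<lambda>i\<in>{..<arity \<Sigma> F}. 0)"
    using cs by (auto simp: fun_eq_iff subsetD intro!: ter_dist_refl)
  have "umap \<Sigma> F (\<lambda>i\<in>{..<arity \<Sigma> F}. 0) = 0"
    by (subst umm_eq_0_iff[OF umap_umm[OF F]]) auto
  then have "(?seq ts, ?seq ss) \<in> ter_rel \<Sigma>" if "list_all2 (\<in>) ts cs" for ts
    using that cs cau fin_dist_Fun_lim[OF F cs(1,2) that cs] by (simp add: z cauchy_rel_def)
  then have "ter_rel \<Sigma> `` {?seq ts} = ter_rel \<Sigma> `` {?seq ss}" if "list_all2 (\<in>) ts cs" for ts
    using that equiv_class_eq[OF equiv_ter_rel] by blast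
  then have "\<Union> {ter_rel \<Sigma> `` {?seq ts} | ts. list_all2 (\<in>) ts cs} = ter_rel \<Sigma> `` {?seq ss}"
    using cs(3) by blast
  moreover have "ter_app \<Sigma> F cs = \<Union> {ter_rel \<Sigma> `` {?seq ts} | ts. list_all2 (\<in>) ts cs}"
    unfolding ter_app_def by blast
  ultimately show ?thesis
    by simp
qed

lemma Ter_args_representatives:
  assumes "set cs \<subseteq> Ter \<Sigma>"
  obtains ss where "list_all2 (\<in>) ss cs"
proof
  have "c \<noteq> {}" if "c \<in> set cs" for c
    using that assms Ter_nonempty[of c] by auto
  then show "list_all2 (\<in>) (map (\<lambda>c. SOME s. s \<in> c) cs) cs"
    by (auto simp: list_all2_conv_all_nth some_in_eq)
qed

lemma ter_app_representative:
  assumes "F \<in> symbols \<Sigma>" "length cs = arity \<Sigma> F" "set cs \<subseteq> Ter \<Sigma>" "list_all2 (\<in>) ss cs"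
  shows "(\<lambda>k. Fun F (map (\<lambda>s. s k) ss)) \<in> ter_app \<Sigma> F cs"
  unfolding ter_app_eq_class[OF assms]
  using assms Ter_args_cauchy by (intro in_class fin_cauchy_Fun) (auto dest: list_all2_lengthD)

lemma ter_app_in_Ter:
  assumes "F \<in> symbols \<Sigma>" "length cs = arity \<Sigma> F" "set cs \<subseteq> Ter \<Sigma>"
  shows "ter_app \<Sigma> F cs \<in> Ter \<Sigma>"
proof -
  obtain ss where ss: "list_all2 (\<in>) ss cs"
    using assms(3) by (rule Ter_args_representatives)
  show ?thesis
    unfolding ter_app_eq_class[OF assms ss]
    using assms ss Ter_args_cauchy
    by (intro class_in_Ter fin_cauchy_Fun) (auto dest: list_all2_lengthD)
qed

lemma ter_dist_app:
  assumes F: "F \<in> symbols \<Sigma>"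
    and cs: "length cs = arity \<Sigma> F" "set cs \<subseteq> Ter \<Sigma>"
    and ds: "length ds = arity \<Sigma> F" "set ds \<subseteq> Ter \<Sigma>"
  shows "ter_dist \<Sigma> (ter_app \<Sigma> F cs) (ter_app \<Sigma> F ds) =
         umap \<Sigma> F (\<lambda>i\<in>{..<arity \<Sigma> F}. ter_dist \<Sigma> (cs ! i) (ds ! i))"
proof -
  obtain ss ts where ss: "list_all2 (\<in>) ss cs" and ts: "list_all2 (\<in>) ts ds"
    using cs(2) ds(2) by (metis Ter_args_representatives)
  show ?thesis
    using ter_app_in_Ter[OF F cs] ter_app_representative[OF F cs ss]
      ter_app_in_Ter[OF F ds] ter_app_representative[OF F ds ts] fin_dist_Fun_lim[OF F cs ss ds ts]
    by (rule ter_dist_eqI)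
qed

lemma Var_in_ter_var: "(\<lambda>_. Var x) \<in> ter_var \<Sigma> x"
  unfolding ter_var_def by (rule in_class) (simp add: fin_cauchy_const fin_terms.Var)

lemma ter_var_in_Ter: "ter_var \<Sigma> x \<in> Ter \<Sigma>"
  unfolding ter_var_def by (rule class_in_Ter) (simp add: fin_cauchy_const fin_terms.Var)

section \<open>Substitution\<close>

lemma fin_subst_in_Ter:
  assumes "\<forall>x. \<sigma> x \<in> Ter \<Sigma>" "t \<in> fin_terms \<Sigma>"
  shows "fin_subst \<Sigma> \<sigma> t \<in> Ter \<Sigma>"
  using assms(2)
  by (induction t) (auto simp: assms(1) intro!: ter_app_in_Ter)

text \<open>If the roots differ, the right-hand side is already 1, the largest possible distance; if
  they agree, \<open>ter_dist_app\<close> and monotonicity of \<open>umap\<close> carry the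
  induction. This is the uniform continuity that extends substitution to the completion.\<close>

lemma fin_subst_nonexpansive:
  fixes t u :: "('f, 'v) fterm"
  assumes \<sigma>: "\<forall>x. \<sigma> x \<in> Ter \<Sigma>" and "t \<in> fin_terms \<Sigma>" "u \<in> fin_terms \<Sigma>"
  shows "ter_dist \<Sigma> (fin_subst \<Sigma> \<sigma> t) (fin_subst \<Sigma> \<sigma> u) \<le> fin_dist \<Sigma> t u"
  using assms(2,3)
proof (induction t arbitrary: u rule: fterm.induct)
  case (Var x)
  have "ter_dist \<Sigma> (\<sigma> x) (fin_subst \<Sigma> \<sigma> u) \<le> 1"
    using ter_dist_range[of "\<sigma> x" "fin_subst \<Sigma> \<sigma> u"] \<sigma> fin_subst_in_Ter Var by auto
  moreover have "ter_dist \<Sigma> (\<sigma> x) (\<sigma> x) = 0"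
    using \<sigma> by (simp add: ter_dist_refl)
  ultimately show ?case
    using Var by (cases u) (auto simp: fin_dist_def)
next
  case (Fun F ts)
  have le1: "ter_dist \<Sigma> (fin_subst \<Sigma> \<sigma> (Fun F ts)) (fin_subst \<Sigma> \<sigma> u) \<le> 1"
    using ter_dist_range[OF fin_subst_in_Ter fin_subst_in_Ter, of \<sigma> "Fun F ts" \<sigma> u] \<sigma> Fun.prems
    by auto
  show ?case
  proof (cases "\<exists>us. u = Fun F us")
    case True
    then obtain us where u: "u = Fun F us"
      by blast
    have F: "F \<in> symbols \<Sigma>" "length ts = arity \<Sigma> F" "length us = arity \<Sigma> F"
      and tsu: "\<forall>t\<in>set ts. t \<in> fin_terms \<Sigma>" "\<forall>t\<in>set us. t \<in> fin_terms \<Sigma>"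
      using Fun.prems u by (auto simp: fin_terms_Fun_iff)
    let ?cs = "map (fin_subst \<Sigma> \<sigma>) ts" and ?ds = "map (fin_subst \<Sigma> \<sigma>) us"
    have sub: "set ?cs \<subseteq> Ter \<Sigma>" "set ?ds \<subseteq> Ter \<Sigma>"
      using tsu fin_subst_in_Ter[OF \<sigma>] by auto
    have "ter_dist \<Sigma> (fin_subst \<Sigma> \<sigma> (Fun F ts)) (fin_subst \<Sigma> \<sigma> u) =
          umap \<Sigma> F (\<lambda>i\<in>{..<arity \<Sigma> F}. ter_dist \<Sigma> (?cs ! i) (?ds ! i))"
      using ter_dist_app[OF F(1) _ sub(1) _ sub(2)] F u by simp
    also have "\<dots> \<le> umap \<Sigma> F (\<lambda>i\<in>{..<arity \<Sigma> F}. fin_dist \<Sigma> (ts ! i) (us ! i))"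
    proof (rule umm_mono[OF umap_umm[OF F(1)]])
      have "ter_dist \<Sigma> (?cs ! i) (?ds ! i) \<in> {0..1}" if "i < arity \<Sigma> F" for i
        using that sub F by (intro ter_dist_range) (metis length_map nth_mem subsetD)+
      then show "(\<lambda>i\<in>{..<arity \<Sigma> F}. ter_dist \<Sigma> (?cs ! i) (?ds ! i)) \<in> cube (arity \<Sigma> F)"
        by (auto simp del: atLeastAtMost_iff)
      show "(\<lambda>i\<in>{..<arity \<Sigma> F}. fin_dist \<Sigma> (ts ! i) (us ! i)) \<in> cube (arity \<Sigma> F)"
        using fin_dist_range by (auto simp del: atLeastAtMost_iff)
      show "(\<lambda>i\<in>{..<arity \<Sigma> F}. ter_dist \<Sigma> (?cs ! i) (?ds ! i)) i
          \<le> (\<lambda>i\<in>{..<arity \<Sigma> F}. fin_dist \<Sigma> (ts ! i) (us ! i)) i" if "i < arity \<Sigma> F" for i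
        using that F tsu Fun.IH[OF nth_mem] by simp
    qed
    also have "\<dots> = fin_dist \<Sigma> (Fun F ts) u"
      using Fun.prems u by (simp add: fin_dist_Fun)
    finally show ?thesis .
  next
    case False
    then have "fin_dist \<Sigma> (Fun F ts) u = 1"
      using Fun.prems by (cases u) (auto simp: fin_dist_def pre_dist_Fun)
    then show ?thesis
      using le1 by simp
  qed
qed

text \<open>Resolves the definite description in \<open>ter_subst\<close>: the images of a
  representing sequence form a Cauchy sequence, completeness provides a limit, and equivalent
  representatives have images at vanishing distance, hence the same limit.\<close>

lemma ter_subst_limit:
  assumes \<sigma>: "\<forall>x. \<sigma> x \<in> Ter \<Sigma>" and c: "c \<in> Ter \<Sigma>" "s \<in> c"
  shows "limitin (ter_topology \<Sigma>) (\<lambda>k. fin_subst \<Sigma> \<sigma> (s k)) (ter_subst \<Sigma> \<sigma> c) sequentially"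
proof -
  interpret T: Metric_space "Ter \<Sigma>" "ter_dist \<Sigma>"
    by (rule Metric_space_Ter)
  have s: "fin_cauchy s"
    using c by (rule Ter_cauchy)
  have "T.MCauchy (\<lambda>k. fin_subst \<Sigma> \<sigma> (s k))"
    unfolding T.MCauchy_def
  proof (intro conjI allI impI)
    show "range (\<lambda>k. fin_subst \<Sigma> \<sigma> (s k)) \<subseteq> Ter \<Sigma>"
      using fin_subst_in_Ter[OF \<sigma> fin_cauchy_in[OF s]] by auto
    fix e :: real assume "0 < e"
    then obtain N where "\<forall>n n'. N \<le> n \<longrightarrow> N \<le> n' \<longrightarrow> fin_dist \<Sigma> (s n) (s n') < e"
      using s unfolding fin_cauchy_def by blast
    then show "\<exists>N. \<forall>n n'. N \<le> n \<longrightarrow> N \<le> n' \<longrightarrow>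
        ter_dist \<Sigma> (fin_subst \<Sigma> \<sigma> (s n)) (fin_subst \<Sigma> \<sigma> (s n')) < e"
      using fin_subst_nonexpansive[OF \<sigma> fin_cauchy_in[OF s] fin_cauchy_in[OF s]] le_less_trans
      by blast
  qed
  then obtain u where u: "limitin (ter_topology \<Sigma>) (\<lambda>k. fin_subst \<Sigma> \<sigma> (s k)) u sequentially"
    using mcomplete_Ter unfolding T.mcomplete_def ter_topology_def by blast
  have "ter_subst \<Sigma> \<sigma> c = u"
    unfolding ter_subst_def
  proof (rule the_equality)
    show "\<forall>s'\<in>c. limitin (ter_topology \<Sigma>) (\<lambda>k. fin_subst \<Sigma> \<sigma> (s' k)) u sequentially"
    proof
      fix s' assume "s' \<in> c"
      then have s': "fin_cauchy s'" and "(s, s') \<in> ter_rel \<Sigma>"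
        using c Ter_cauchy Ter_rel by auto
      then have lim: "(\<lambda>k. fin_dist \<Sigma> (s k) (s' k)) \<longlonglongrightarrow> 0"
        by (simp add: cauchy_rel_def)
      show "limitin (ter_topology \<Sigma>) (\<lambda>k. fin_subst \<Sigma> \<sigma> (s' k)) u sequentially"
      proof (rule ter_limit_cong[OF u])
        show "fin_subst \<Sigma> \<sigma> (s' k) \<in> Ter \<Sigma>" for k
          using fin_subst_in_Ter[OF \<sigma> fin_cauchy_in[OF s']] .
        show "(\<lambda>k. ter_dist \<Sigma> (fin_subst \<Sigma> \<sigma> (s k)) (fin_subst \<Sigma> \<sigma> (s' k))) \<longlonglongrightarrow> 0"
          by (rule Lim_null_comparison[OF _ lim])
             (simp add: fin_subst_nonexpansive[OF \<sigma> fin_cauchy_in[OF s] fin_cauchy_in[OF s']])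
      qed
    qed
    show "u' = u"
      if "\<forall>s\<in>c. limitin (ter_topology \<Sigma>) (\<lambda>k. fin_subst \<Sigma> \<sigma> (s k)) u' sequentially" for u'
      using ter_limit_unique[OF _ u] that c by auto
  qed
  then show ?thesis
    using u by simp
qed

lemma ter_subst_eqI:
  assumes "\<forall>x. \<sigma> x \<in> Ter \<Sigma>" "c \<in> Ter \<Sigma>" "s \<in> c"
    and "limitin (ter_topology \<Sigma>) (\<lambda>k. fin_subst \<Sigma> \<sigma> (s k)) u sequentially"
  shows "ter_subst \<Sigma> \<sigma> c = u"
  using ter_limit_unique[OF ter_subst_limit[OF assms(1-3)] assms(4)] by simp

lemma ter_subst_in_Ter:
  assumes "\<forall>x. \<sigma> x \<in> Ter \<Sigma>" "c \<in> Ter \<Sigma>"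
  shows "ter_subst \<Sigma> \<sigma> c \<in> Ter \<Sigma>"
  using assms by (metis Ter_nonempty ter_limit_iff ter_subst_limit)

end

lemma (in metric_sig) continuous_map_ter_iff:
  "continuous_map X (ter_topology \<Sigma>) f \<longleftrightarrow>
     (\<forall>x\<in>topspace X. f x \<in> Ter \<Sigma> \<and>
        (\<forall>e>0. \<exists>U. openin X U \<and> x \<in> U \<and> (\<forall>y\<in>U. ter_dist \<Sigma> (f x) (f y) < e)))"
  unfolding ter_topology_def
  by (rule Metric_space.continuous_map_into_mtopology_iff[OF Metric_space_Ter])

section \<open>Embeddings of signatures\<close>

text \<open>The two types of symbols may differ, so as to cover \<open>id\<close> into a union,
  \<open>Some\<close> into an indirected signature, and \<open>map_option\<close> between indirected
  signatures.\<close>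

locale sig_embedding = src: metric_sig \<Sigma> + tgt: metric_sig \<Delta>
  for \<Sigma> :: "'f msig" and \<Delta> :: "'g msig" +
  fixes \<phi> :: "'f \<Rightarrow> 'g"
  assumes inj: "inj_on \<phi> (symbols \<Sigma>)"
    and symbol: "F \<in> symbols \<Sigma> \<Longrightarrow> \<phi> F \<in> symbols \<Delta>"
    and arity_eq: "F \<in> symbols \<Sigma> \<Longrightarrow> arity \<Delta> (\<phi> F) = arity \<Sigma> F"
    and umap_eq: "F \<in> symbols \<Sigma> \<Longrightarrow> umap \<Delta> (\<phi> F) = umap \<Sigma> F"
begin

abbreviation map_symbols :: "('f, 'v) fterm \<Rightarrow> ('g, 'v) fterm" where
  "map_symbols \<equiv> map_fterm \<phi> id"

abbreviation \<iota> :: "('f, 'v) ter \<Rightarrow> ('g, 'v) ter" where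
  "\<iota> \<equiv> ter_embed \<Delta> \<phi>"

lemma map_symbols_in_fin_terms: "t \<in> fin_terms \<Sigma> \<Longrightarrow> map_symbols t \<in> fin_terms \<Delta>"
  by (induction t rule: fin_terms.induct)
     (auto simp: fin_terms_Fun_iff symbol arity_eq intro: fin_terms.Var)

text \<open>Equal roots are handled by \<open>umap_eq\<close>; for distinct roots injectivity keeps
  the distance at 1, where a collapse could shorten it.\<close>

lemma pre_dist_map_symbols:
  fixes t u :: "('f, 'v) fterm"
  assumes "t \<in> fin_terms \<Sigma>" "u \<in> fin_terms \<Sigma>"
  shows "pre_dist (umap \<Delta>) (map_symbols t) (map_symbols u) = pre_dist (umap \<Sigma>) t u"
  using assms
proof (induction t arbitrary: u rule: fterm.induct)
  case (Var x)
  then show ?case by (cases u) auto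
next
  case (Fun F ts)
  show ?case
  proof (cases u)
    case (Fun G us)
    have FG: "F \<in> symbols \<Sigma>" "G \<in> symbols \<Sigma>"
      using Fun.prems Fun by (auto simp: fin_terms_Fun_iff)
    show ?thesis
    proof (cases "F = G")
      case True
      have "(\<lambda>i\<in>{..<length ts}. pre_dist (umap \<Delta>) (map_symbols (ts ! i)) (map_symbols (us ! i))) =
            (\<lambda>i\<in>{..<length ts}. pre_dist (umap \<Sigma>) (ts ! i) (us ! i))"
        using Fun.IH[OF nth_mem] Fun.prems Fun True by (auto simp: fin_terms_Fun_iff fun_eq_iff id_def)
      moreover have "(\<lambda>i\<in>{..<length ts}. pre_dist (umap \<Delta>) (map map_symbols ts ! i) (map map_symbols us ! i)) =
           (\<lambda>i\<in>{..<length ts}. pre_dist (umap \<Delta>) (map_symbols (ts ! i)) (map_symbols (us ! i)))"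
        using Fun.prems Fun True by (auto simp: fin_terms_Fun_iff fun_eq_iff)
      ultimately show ?thesis
        using True Fun FG by (simp add: pre_dist_Fun umap_eq id_def)
    next
      case False
      then have "\<phi> F \<noteq> \<phi> G"
        using inj FG by (auto dest: inj_onD)
      then show ?thesis
        using False Fun by (simp add: pre_dist_Fun)
    qed
  qed simp
qed

lemma fin_dist_map_symbols:
  assumes "t \<in> fin_terms \<Sigma>" "u \<in> fin_terms \<Sigma>"
  shows "fin_dist \<Delta> (map_symbols t) (map_symbols u) = fin_dist \<Sigma> t u"
  using assms by (simp add: fin_dist_def map_symbols_in_fin_terms pre_dist_map_symbols)

lemma fin_cauchy_map_symbols:
  assumes "src.fin_cauchy s"
  shows "tgt.fin_cauchy (\<lambda>k. map_symbols (s k))"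
  using assms
  by (auto simp: tgt.fin_cauchy_def src.fin_cauchy_def fin_dist_map_symbols
      map_symbols_in_fin_terms src.fin_cauchy_in[OF assms])

text \<open>The image of a class need not be a full class of the target, which may contain further
  sequences with foreign symbols; closing under \<open>ter_rel\<close> adds them. Images of
  equivalent sequences are equivalent, so a single class results.\<close>

lemma ter_embed_eq_class:
  assumes "c \<in> Ter \<Sigma>" "s \<in> c"
  shows "\<iota> c = ter_rel \<Delta> `` {\<lambda>k. map_symbols (s k)}"
proof -
  have "((\<lambda>k. map_symbols (t k)), (\<lambda>k. map_symbols (s k))) \<in> ter_rel \<Delta>" if "t \<in> c" for t
  proof -
    have "(t, s) \<in> ter_rel \<Sigma>"
      using src.Ter_rel assms that by blast
    then show ?thesis
      by (auto simp: cauchy_rel_def fin_cauchy_map_symbols fin_dist_map_symbols src.fin_cauchy_in)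
  qed
  then have "ter_rel \<Delta> `` {\<lambda>k. map_symbols (t k)} = ter_rel \<Delta> `` {\<lambda>k. map_symbols (s k)}"
    if "t \<in> c" for t
    using that equiv_class_eq[OF tgt.equiv_ter_rel] by blast
  moreover have "\<iota> c = (\<Union>t\<in>c. ter_rel \<Delta> `` {\<lambda>k. map_symbols (t k)})"
    unfolding ter_embed_def by blast
  ultimately show ?thesis
    \<comment> \<open>A union of a constant family equals its member only over a nonempty index set;
      s shows that c is nonempty.\<close>
    using SUP_eq_const[of c "\<lambda>t. ter_rel \<Delta> `` {\<lambda>k. map_symbols (t k)}"] assms(2)
    by (metis empty_iff)
qed

lemma ter_embed_in_Ter:
  assumes "c \<in> Ter \<Sigma>"
  shows "\<iota> c \<in> Ter \<Delta>"
proof -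
  obtain s where s: "s \<in> c"
    using assms by (rule src.Ter_nonempty)
  show ?thesis
    unfolding ter_embed_eq_class[OF assms s]
    using src.Ter_cauchy[OF assms s] by (intro tgt.class_in_Ter fin_cauchy_map_symbols)
qed

lemma ter_embed_representative:
  assumes "c \<in> Ter \<Sigma>" "s \<in> c"
  shows "(\<lambda>k. map_symbols (s k)) \<in> \<iota> c"
  unfolding ter_embed_eq_class[OF assms]
  using src.Ter_cauchy[OF assms] by (intro tgt.in_class fin_cauchy_map_symbols)

lemma ter_dist_embed:
  assumes c: "c \<in> Ter \<Sigma>" and c': "c' \<in> Ter \<Sigma>"
  shows "ter_dist \<Delta> (\<iota> c) (\<iota> c') = ter_dist \<Sigma> c c'"
proof -
  obtain s t where s: "s \<in> c" and t: "t \<in> c'"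
    using c c' by (metis src.Ter_nonempty)
  show ?thesis
  proof (rule tgt.ter_dist_eqI[OF ter_embed_in_Ter[OF c] ter_embed_representative[OF c s]
        ter_embed_in_Ter[OF c'] ter_embed_representative[OF c' t]])
    show "(\<lambda>n. fin_dist \<Delta> (map_symbols (s n)) (map_symbols (t n))) \<longlonglongrightarrow> ter_dist \<Sigma> c c'"
      using src.ter_dist_lim[OF c s c' t] src.fin_cauchy_in[OF src.Ter_cauchy[OF c s]]
        src.fin_cauchy_in[OF src.Ter_cauchy[OF c' t]]
      by (simp add: fin_dist_map_symbols)
  qed
qed

lemma ter_embed_var: "\<iota> (ter_var \<Sigma> x) = ter_var \<Delta> x"
  using ter_embed_eq_class[OF src.ter_var_in_Ter src.Var_in_ter_var] by (simp add: ter_var_def)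

lemma ter_embed_app:
  assumes F: "F \<in> symbols \<Sigma>" and cs: "length cs = arity \<Sigma> F" "set cs \<subseteq> Ter \<Sigma>"
  shows "\<iota> (ter_app \<Sigma> F cs) = ter_app \<Delta> (\<phi> F) (map \<iota> cs)"
proof -
  obtain ss where ss: "list_all2 (\<in>) ss cs"
    using cs(2) by (rule src.Ter_args_representatives)
  have "list_all2 (\<in>) (map (\<lambda>s k. map_symbols (s k)) ss) (map \<iota> cs)"
    using ss cs
    by (auto simp: list_all2_conv_all_nth intro!: ter_embed_representative)
  moreover have "set (map \<iota> cs) \<subseteq> Ter \<Delta>"
    using cs(2) ter_embed_in_Ter by auto
  ultimately have "ter_app \<Delta> (\<phi> F) (map \<iota> cs) =
      ter_rel \<Delta> `` {\<lambda>k. Fun (\<phi> F) (map (\<lambda>s. s k) (map (\<lambda>s k. map_symbols (s k)) ss))}"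
    using F cs by (intro tgt.ter_app_eq_class) (auto simp: symbol arity_eq)
  also have "\<dots> = \<iota> (ter_app \<Sigma> F cs)"
    using ter_embed_eq_class[OF src.ter_app_in_Ter[OF F cs] src.ter_app_representative[OF F cs ss]]
    by (simp add: o_def)
  finally show ?thesis ..
qed

lemma ter_embed_fin_subst:
  fixes t :: "('f, 'v) fterm"
  assumes \<sigma>: "\<forall>x. \<sigma> x \<in> Ter \<Sigma>" and "t \<in> fin_terms \<Sigma>"
  shows "\<iota> (fin_subst \<Sigma> \<sigma> t) = fin_subst \<Delta> (\<lambda>x. \<iota> (\<sigma> x)) (map_symbols t)"
  using assms(2)
proof (induction t rule: fin_terms.induct)
  case (Fun F ts)
  then have "set (map (fin_subst \<Sigma> \<sigma>) ts) \<subseteq> Ter \<Sigma>"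
    using src.fin_subst_in_Ter[OF \<sigma>] by auto
  then have "\<iota> (fin_subst \<Sigma> \<sigma> (Fun F ts)) = ter_app \<Delta> (\<phi> F) (map \<iota> (map (fin_subst \<Sigma> \<sigma>) ts))"
    using Fun by (simp add: ter_embed_app)
  also have "map \<iota> (map (fin_subst \<Sigma> \<sigma>) ts) =
      map (fin_subst \<Delta> (\<lambda>x. \<iota> (\<sigma> x))) (map map_symbols ts)"
    using Fun by (simp add: id_def)
  finally show ?case
    by (simp add: id_def)
qed simp

lemma ter_embed_limit:
  assumes "limitin (ter_topology \<Sigma>) f u sequentially" "\<And>n. f n \<in> Ter \<Sigma>"
  shows "limitin (ter_topology \<Delta>) (\<lambda>n. \<iota> (f n)) (\<iota> u) sequentially"
  using assms by (simp add: src.ter_limit_iff tgt.ter_limit_iff ter_embed_in_Ter ter_dist_embed)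

text \<open>Both sides are limits of one sequence: the embedded instances of the finite
  approximations s k, on which the claim is \<open>ter_embed_fin_subst\<close>.\<close>

lemma ter_embed_subst:
  assumes \<sigma>: "\<forall>x. \<sigma> x \<in> Ter \<Sigma>" and c: "c \<in> Ter \<Sigma>"
  shows "\<iota> (ter_subst \<Sigma> \<sigma> c) = ter_subst \<Delta> (\<lambda>x. \<iota> (\<sigma> x)) (\<iota> c)"
proof -
  obtain s where s: "s \<in> c"
    using c by (rule src.Ter_nonempty)
  have sin: "s k \<in> fin_terms \<Sigma>" for k
    using src.fin_cauchy_in[OF src.Ter_cauchy[OF c s]] .
  have "limitin (ter_topology \<Delta>) (\<lambda>k. \<iota> (fin_subst \<Sigma> \<sigma> (s k))) (\<iota> (ter_subst \<Sigma> \<sigma> c)) sequentially"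
    using src.ter_subst_limit[OF \<sigma> c s] src.fin_subst_in_Ter[OF \<sigma> sin] by (rule ter_embed_limit)
  then have "limitin (ter_topology \<Delta>)
      (\<lambda>k. fin_subst \<Delta> (\<lambda>x. \<iota> (\<sigma> x)) (map_symbols (s k))) (\<iota> (ter_subst \<Sigma> \<sigma> c)) sequentially"
    by (simp add: ter_embed_fin_subst[OF \<sigma> sin])
  then show ?thesis
    using ter_embed_in_Ter \<sigma> ter_embed_in_Ter[OF c] ter_embed_representative[OF c s]
    by (intro tgt.ter_subst_eqI[symmetric]) auto
qed

text \<open>Read forwards, it embeds reduction sequences; read backwards, it pulls back their
  continuous extensions. The inclusion on the right is stated separately because embedding says
  nothing about the status of values outside \<open>Ter\<close>.\<close>

lemma continuous_map_embed_iff: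
  "continuous_map X (ter_topology \<Sigma>) f \<longleftrightarrow>
     f ` topspace X \<subseteq> Ter \<Sigma> \<and> continuous_map X (ter_topology \<Delta>) (\<lambda>x. \<iota> (f x))"
proof (cases "f ` topspace X \<subseteq> Ter \<Sigma>")
  case True
  have "(\<forall>y\<in>U. ter_dist \<Delta> (\<iota> (f x)) (\<iota> (f y)) < e) \<longleftrightarrow> (\<forall>y\<in>U. ter_dist \<Sigma> (f x) (f y) < e)"
    if "openin X U" "x \<in> topspace X" for x U e
  proof (rule ball_cong[OF refl])
    fix y assume "y \<in> U"
    then have "y \<in> topspace X"
      using openin_subset[OF that(1)] by blast
    then show "ter_dist \<Delta> (\<iota> (f x)) (\<iota> (f y)) < e \<longleftrightarrow> ter_dist \<Sigma> (f x) (f y) < e"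
      using True that(2) by (simp add: ter_dist_embed image_subset_iff)
  qed
  then show ?thesis
    using True
    by (simp add: src.continuous_map_ter_iff tgt.continuous_map_ter_iff ter_embed_in_Ter
        image_subset_iff cong: conj_cong)
next
  case False
  then show ?thesis
    by (auto simp: src.continuous_map_ter_iff)
qed

text \<open>Closeness is assumed through distances, to suit a limit along an arbitrary ordinal.
  Choosing points within 1/(n+1) gives a sequence whose image converges; by isometry the sequence
  itself is Cauchy, and its limit in the complete source is mapped to c.\<close>

lemma ter_embed_image_closed:
  fixes c :: "('g, 'v) ter"
  assumes c: "c \<in> Ter \<Delta>" and close: "\<And>e. e > 0 \<Longrightarrow> \<exists>a\<in>Ter \<Sigma>. ter_dist \<Delta> (\<iota> a) c < e"
  obtains a where "a \<in> Ter \<Sigma>" "\<iota> a = c"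
proof -
  interpret S: Metric_space "Ter \<Sigma> :: ('f, 'v) ter set" "ter_dist \<Sigma>"
    by (rule src.Metric_space_Ter)
  interpret D: Metric_space "Ter \<Delta> :: ('g, 'v) ter set" "ter_dist \<Delta>"
    by (rule tgt.Metric_space_Ter)
  have "\<exists>a. a \<in> Ter \<Sigma> \<and> ter_dist \<Delta> (\<iota> a) c < inverse (real (Suc n))" for n
    using close[of "inverse (real (Suc n))"] by auto
  then obtain a where a: "\<And>n. a n \<in> Ter \<Sigma>"
    and lt: "\<And>n. ter_dist \<Delta> (\<iota> (a n)) c < inverse (real (Suc n))"
    by metis
  have ia: "\<iota> (a n) \<in> Ter \<Delta>" for n
    using a ter_embed_in_Ter by blast
  have "(\<lambda>n. ter_dist \<Delta> (\<iota> (a n)) c) \<longlonglongrightarrow> 0"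
    by (rule tendsto_sandwich[OF _ _ tendsto_const LIMSEQ_inverse_real_of_nat])
       (use lt in \<open>auto simp: less_imp_le\<close>)
  then have lim: "limitin (ter_topology \<Delta>) (\<lambda>n. \<iota> (a n)) c sequentially"
    using c ia by (simp add: tgt.ter_limit_iff)
  then have "D.MCauchy (\<lambda>n. \<iota> (a n))"
    using ia by (intro D.convergent_imp_MCauchy) (auto simp: ter_topology_def)
  then have "S.MCauchy a"
    using a by (auto simp: S.MCauchy_def D.MCauchy_def ter_dist_embed)
  moreover have S.mcomplete
    by (rule src.mcomplete_Ter)
  ultimately obtain b where b: "limitin (ter_topology \<Sigma>) a b sequentially"
    unfolding S.mcomplete_def ter_topology_def by blast
  then have "\<iota> b = c"
    using tgt.ter_limit_unique[OF ter_embed_limit[OF b a] lim] by simp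
  then show thesis
    using that b by (auto simp: src.ter_limit_iff)
qed

end

lemma ter_embed_comp:
  assumes "sig_embedding \<Sigma> \<Delta> \<phi>" "sig_embedding \<Delta> \<Theta> \<psi>" and c: "c \<in> Ter \<Sigma>"
  shows "ter_embed \<Theta> \<psi> (ter_embed \<Delta> \<phi> c) = ter_embed \<Theta> (\<psi> \<circ> \<phi>) c"
proof -
  interpret A: sig_embedding \<Sigma> \<Delta> \<phi> by fact
  interpret B: sig_embedding \<Delta> \<Theta> \<psi> by fact
  interpret AB: sig_embedding \<Sigma> \<Theta> "\<psi> \<circ> \<phi>"
  proof
    show "inj_on (\<psi> \<circ> \<phi>) (symbols \<Sigma>)"
      using A.inj B.inj A.symbol by (auto simp: inj_on_def)
  qed (auto simp: A.symbol A.arity_eq A.umap_eq B.symbol B.arity_eq B.umap_eq)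
  obtain s where s: "s \<in> c"
    using c by (rule A.src.Ter_nonempty)
  show ?thesis
    using B.ter_embed_eq_class[OF A.ter_embed_in_Ter[OF c] A.ter_embed_representative[OF c s]]
      AB.ter_embed_eq_class[OF c s]
    by (simp add: fterm.map_comp)
qed

section \<open>Transfer of convergence along embeddings\<close>

lemma topspace_ord_topology: "topspace (ord_topology r) = Field r"
  by (auto simp: ord_topology_def underS_def aboveS_def intro: FieldI1 FieldI2)

lemma Field_ord_succ: "Field (ord_succ r) = insert None (Some ` Field r)"
  unfolding ord_succ_def Field_def by force

text \<open>The added point \<open>None\<close> is not isolated when r is a limit ordinal: each of
  its neighbourhoods contains a whole tail of r.\<close>

lemma ord_succ_top_neighbourhood:
  assumes r: "limit_ord r" and U: "openin (ord_topology (ord_succ r)) U" "None \<in> U"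
  obtains b where "b \<in> Field r" "Some b \<in> U"
proof -
  have wo: "Well_order r" and ne: "Field r \<noteq> {}" and lim: "\<forall>a\<in>Field r. aboveS r a \<noteq> {}"
    using r by (auto simp: limit_ord_def)
  have mono: "aboveS r b \<subseteq> aboveS r a" if "(a, b) \<in> r" for a b
    using wo that unfolding aboveS_def order_on_defs trans_def antisym_def by blast
  have total: "(a, b) \<in> r \<or> (b, a) \<in> r" if "a \<in> Field r" "b \<in> Field r" for a b
    using wo that unfolding order_on_defs total_on_def refl_on_def by metis
  have "generate_topology_on ({Field (ord_succ r)} \<union> {underS (ord_succ r) a |a. a \<in> Field (ord_succ r)}
      \<union> {aboveS (ord_succ r) a |a. a \<in> Field (ord_succ r)}) U"
    using U(1) by (simp add: ord_topology_def openin_topology_generated_by_iff)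
  \<comment> \<open>The induction over generated open sets needs tails rather than single points:
    two tails intersect in the later one, whereas two points may be unrelated.\<close>
  then have "None \<in> U \<Longrightarrow> \<exists>a\<in>Field r. Some ` aboveS r a \<subseteq> U"
  proof (induction rule: generate_topology_on.induct)
    case Empty
    then show ?case by simp
  next
    case (Int V W)
    then obtain a b where ab: "a \<in> Field r" "b \<in> Field r"
      "Some ` aboveS r a \<subseteq> V" "Some ` aboveS r b \<subseteq> W"
      by auto
    then show ?case
      using total[OF ab(1,2)] mono by blast
  next
    case (UN K)
    then show ?case by blast
  next
    case (Basis V)
    then consider "V = Field (ord_succ r)" | a where "V = underS (ord_succ r) a"
      | a where "a \<in> Field (ord_succ r)" "V = aboveS (ord_succ r) a"
      by blast
    then show ?case
    proof cases
      case 1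
      then show ?thesis
        using ne by (auto simp: Field_ord_succ aboveS_def intro: FieldI2)
    next
      case 2
      then show ?thesis
        \<comment> \<open>An initial segment cannot contain \<open>None\<close>, the greatest
          element.\<close>
        using Basis.prems by (auto simp: underS_def ord_succ_def)
    next
      case 3
      \<comment> \<open>The bound is not \<open>None\<close> itself, since \<open>None\<close> is
        not strictly above \<open>None\<close>.\<close>
      then obtain b where "b \<in> Field r" "a = Some b"
        using Basis.prems by (auto simp: Field_ord_succ aboveS_def)
      moreover from this have "Some ` aboveS r b \<subseteq> V"
        using 3 by (force simp: aboveS_def ord_succ_def)
      ultimately show ?thesis
        by blast
    qed
  qed
  then obtain a where "a \<in> Field r" "Some ` aboveS r a \<subseteq> U"
    using U(2) by blast
  \<comment> \<open>Here the limit property enters: it makes the tail nonempty.\<close>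
  moreover from this obtain b where "b \<in> aboveS r a"
    using lim by blast
  ultimately show thesis
    by (intro that[of b]) (auto simp: aboveS_def intro: FieldI2)
qed

text \<open>Rules are sent from R to S only, matching the argument: reductions move forward, and
  just a limit point is pulled back.\<close>

locale itrs_embedding = sig_embedding "sig R" "sig S" \<phi>
  for R :: "('f, 'v) itrs" and S :: "('g, 'v) itrs" and \<phi> :: "'f \<Rightarrow> 'g" +
  assumes rules_in_Ter: "(l, r) \<in> rules R \<Longrightarrow> l \<in> Ter (sig R) \<and> r \<in> Ter (sig R)"
    and rules_embed: "(l, r) \<in> rules R \<Longrightarrow> (\<iota> l, \<iota> r) \<in> rules S"
begin

text \<open>Membership in \<open>Ter\<close> is proved in the same induction, because the
  commutation of the embedding with substitution and application is stated for genuine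
  terms.\<close>

lemma rstep_embed:
  assumes "rstep R t u"
  shows "t \<in> Ter (sig R) \<and> u \<in> Ter (sig R) \<and> rstep S (\<iota> t) (\<iota> u)"
  using assms
proof (induction rule: rstep.induct)
  case (rule l r)
  then show ?case
    using rules_in_Ter rules_embed rstep.rule by blast
next
  case (subst t u \<sigma>)
  then have "rstep S (ter_subst (sig S) (\<lambda>x. \<iota> (\<sigma> x)) (\<iota> t)) (ter_subst (sig S) (\<lambda>x. \<iota> (\<sigma> x)) (\<iota> u))"
    by (intro rstep.subst) (auto intro: ter_embed_in_Ter)
  then show ?case
    using subst by (simp add: ter_embed_subst src.ter_subst_in_Ter)
next
  case (ctxt t u F cs i)
  have sub: "set (cs[i := t]) \<subseteq> Ter (sig R)" "set (cs[i := u]) \<subseteq> Ter (sig R)"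
    using ctxt set_update_subset_insert[of cs i] by blast+
  have "rstep S (ter_app (sig S) (\<phi> F) ((map \<iota> cs)[i := \<iota> t]))
                (ter_app (sig S) (\<phi> F) ((map \<iota> cs)[i := \<iota> u]))"
    using ctxt by (intro rstep.ctxt) (auto simp: symbol arity_eq intro: ter_embed_in_Ter)
  then show ?case
    using ctxt sub by (simp add: ter_embed_app src.ter_app_in_Ter map_update)
qed

lemma reduction_seq_embed:
  assumes "reduction_seq R r f"
  shows "reduction_seq S r (\<lambda>\<beta>. \<iota> (f \<beta>))"
  using assms rstep_embed continuous_map_embed_iff[of "ord_topology r" f]
  by (simp add: reduction_seq_def)

lemma seq_converges_reflect:
  assumes r: "limit_ord r" and f: "reduction_seq R r f"
    and conv: "seq_converges S r (\<lambda>\<beta>. \<iota> (f \<beta>))"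
  shows "seq_converges R r f"
proof -
  obtain g where g: "continuous_map (ord_topology (ord_succ r)) (ter_topology (sig S)) g"
    and gf: "\<forall>\<beta>\<in>Field r. g (Some \<beta>) = \<iota> (f \<beta>)"
    using conv by (auto simp: seq_converges_def)
  have fT: "f \<beta> \<in> Ter (sig R)" if "\<beta> \<in> Field r" for \<beta>
    using f that unfolding reduction_seq_def src.continuous_map_ter_iff topspace_ord_topology by blast
  have top: "None \<in> topspace (ord_topology (ord_succ r))"
    by (simp add: topspace_ord_topology Field_ord_succ)
  have gN: "g None \<in> Ter (sig S)"
    using g top by (auto simp: tgt.continuous_map_ter_iff)
  have "\<exists>a\<in>Ter (sig R). ter_dist (sig S) (\<iota> a) (g None) < e" if "e > 0" for e
  proof -
    obtain U where U: "openin (ord_topology (ord_succ r)) U" "None \<in> U"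
      and d: "\<forall>y\<in>U. ter_dist (sig S) (g None) (g y) < e"
      using bspec[OF g[unfolded tgt.continuous_map_ter_iff] top] \<open>e > 0\<close> by metis
    \<comment> \<open>A neighbourhood on which g stays e-close to its top value contains a point of
      the sequence, so an embedded term is e-close to the limit.\<close>
    obtain b where "b \<in> Field r" "Some b \<in> U"
      using ord_succ_top_neighbourhood[OF r U] .
    then have "ter_dist (sig S) (\<iota> (f b)) (g None) < e"
      using d gf by (force simp: Metric_space.commute[OF tgt.Metric_space_Ter, of "g None"])
    then show ?thesis
      using fT[OF \<open>b \<in> Field r\<close>] by blast
  qed
  then obtain a where a: "a \<in> Ter (sig R)" "\<iota> a = g None"
    using ter_embed_image_closed[OF gN] by blast
  \<comment> \<open>The extension in R takes the preimage of the limit as its top value; embedding h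
    then reproduces g on the whole field, and continuity reflects.\<close>
  define h where "h = case_option a f"
  have "continuous_map (ord_topology (ord_succ r)) (ter_topology (sig S)) (\<lambda>x. \<iota> (h x))"
    by (rule continuous_map_eq[OF g])
       (use gf a in \<open>auto simp: h_def topspace_ord_topology Field_ord_succ\<close>)
  moreover have "h ` topspace (ord_topology (ord_succ r)) \<subseteq> Ter (sig R)"
    using a fT by (auto simp: h_def topspace_ord_topology Field_ord_succ)
  ultimately have "continuous_map (ord_topology (ord_succ r)) (ter_topology (sig R)) h"
    by (simp add: continuous_map_embed_iff)
  then show ?thesis
    unfolding seq_converges_def by (intro exI[of _ h]) (simp add: h_def)
qed

lemma itrs_convergent_reflect:
  assumes "itrs_convergent TYPE('i) S"
  shows "itrs_convergent TYPE('i) R"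
  using assms reduction_seq_embed seq_converges_reflect unfolding itrs_convergent_def by blast

end

section \<open>Indirection\<close>

lemma continuous_umm_identity: "continuous_umm 1 (\<lambda>x. x 0)"
proof -
  have "continuous_map (product_topology (\<lambda>_. top_of_set {0..1}) {..<1 :: nat}) (top_of_set {0..1})
          (\<lambda>x. x 0 :: real)"
    by (rule continuous_map_product_projection) simp
  then show ?thesis
    by (auto simp: continuous_umm_def umm_def PiE_iff)
qed

lemma metric_sig_indirect: "metric_sig \<Sigma> \<Longrightarrow> metric_sig (indirect_sig \<Sigma>)"
  using continuous_umm_identity
  by (auto simp: metric_sig_def term_metric_def indirect_sig_def)

lemma sig_embedding_Some:
  assumes "metric_sig \<Sigma>"
  shows "sig_embedding \<Sigma> (indirect_sig \<Sigma>) Some"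
  using assms metric_sig_indirect[OF assms]
  by (auto simp: sig_embedding_def sig_embedding_axioms_def indirect_sig_def)

lemma (in sig_embedding) sig_embedding_indirect:
  "sig_embedding (indirect_sig \<Sigma>) (indirect_sig \<Delta>) (map_option \<phi>)"
  using inj symbol arity_eq umap_eq metric_sig_indirect[OF src.metric_sig_axioms]
    metric_sig_indirect[OF tgt.metric_sig_axioms]
  by (auto simp: sig_embedding_def sig_embedding_axioms_def indirect_sig_def inj_on_def)

lemma (in itrs_embedding) itrs_embedding_indirected:
  "itrs_embedding (indirected R) (indirected S) (map_option \<phi>)"
proof -
  let ?\<Sigma> = "indirect_sig (sig R)" and ?\<Delta> = "indirect_sig (sig S)"
  interpret I: sig_embedding ?\<Sigma> ?\<Delta> "map_option \<phi>"
    by (rule sig_embedding_indirect)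
  interpret SR: sig_embedding "sig R" ?\<Sigma> Some
    by (rule sig_embedding_Some) (rule src.metric_sig_axioms)
  interpret SS: sig_embedding "sig S" ?\<Delta> Some
    by (rule sig_embedding_Some) (rule tgt.metric_sig_axioms)
  have None: "None \<in> symbols ?\<Sigma>" "arity ?\<Sigma> None = 1"
    by (auto simp: indirect_sig_def)
  have app: "ter_app ?\<Sigma> None [c] \<in> Ter ?\<Sigma>" "I.\<iota> (ter_app ?\<Sigma> None [c]) = ter_app ?\<Delta> None [I.\<iota> c]"
    if "c \<in> Ter ?\<Sigma>" for c
    using that None I.ter_embed_app[of None "[c]"] by (auto intro!: I.src.ter_app_in_Ter)
  \<comment> \<open>Indirecting first or embedding first makes no difference: both composites embed
    along \<open>Some \<circ> \<phi>\<close>. This matches the translated rules on the two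
    sides.\<close>
  have emb: "I.\<iota> (SR.\<iota> c) = SS.\<iota> (\<iota> c)" if "c \<in> Ter (sig R)" for c
    using ter_embed_comp[OF SR.sig_embedding_axioms I.sig_embedding_axioms that]
      ter_embed_comp[OF sig_embedding_axioms SS.sig_embedding_axioms that]
    by (simp add: o_def)
  have sigs: "sig (indirected R) = ?\<Sigma>" "sig (indirected S) = ?\<Delta>"
    by (auto simp: indirected_def Let_def)
  show ?thesis
  proof (intro itrs_embedding.intro itrs_embedding_axioms.intro)
    show "sig_embedding (sig (indirected R)) (sig (indirected S)) (map_option \<phi>)"
      using I.sig_embedding_axioms by (simp add: sigs)
    fix l r assume "(l, r) \<in> rules (indirected R)"
    then consider l' r' where "(l', r') \<in> rules R" "l = SR.\<iota> l'" "r = ter_app ?\<Sigma> None [SR.\<iota> r']"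
      | x where "l = ter_app ?\<Sigma> None [ter_var ?\<Sigma> x]" "r = ter_var ?\<Sigma> x"
      by (auto simp: indirected_def Let_def)
    then have "(l \<in> Ter ?\<Sigma> \<and> r \<in> Ter ?\<Sigma>) \<and> (I.\<iota> l, I.\<iota> r) \<in> rules (indirected S)"
    proof cases
      case 1
      then have T: "l' \<in> Ter (sig R)" "r' \<in> Ter (sig R)" and "(\<iota> l', \<iota> r') \<in> rules S"
        using rules_in_Ter rules_embed by auto
      then show ?thesis
        using 1 by (auto simp: app emb SR.ter_embed_in_Ter indirected_def Let_def)
    next
      case 2
      then show ?thesis
        by (auto simp: app I.ter_embed_var I.src.ter_var_in_Ter indirected_def Let_def)
    qed
    then show "l \<in> Ter (sig (indirected R)) \<and> r \<in> Ter (sig (indirected R))"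
      "(ter_embed (sig (indirected S)) (map_option \<phi>) l,
        ter_embed (sig (indirected S)) (map_option \<phi>) r) \<in> rules (indirected S)"
      by (simp_all add: sigs)
  qed
qed

lemma (in itrs_embedding) strongly_convergent_reflect:
  assumes "strongly_convergent TYPE('i) S"
  shows "strongly_convergent TYPE('i) R"
  using assms itrs_embedding.itrs_convergent_reflect[OF itrs_embedding_indirected]
  by (simp add: strongly_convergent_def)

section \<open>Disjoint unions\<close>

lemma metric_sig_union:
  "metric_sig \<Sigma> \<Longrightarrow> metric_sig \<Delta> \<Longrightarrow> metric_sig (sig_union \<Sigma> \<Delta>)"
  by (auto simp: metric_sig_def term_metric_def sig_union_def)

text \<open>On a shared symbol \<open>sig_union\<close> follows the first signature; disjointness
  ensures that it agrees with the second one on that signature's symbols.\<close>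

lemma sig_embedding_union:
  assumes "metric_sig \<Sigma>" "metric_sig \<Delta>"
  shows "sig_embedding \<Sigma> (sig_union \<Sigma> \<Delta>) id"
    and "disjoint_sigs \<Sigma> \<Delta> \<Longrightarrow> sig_embedding \<Delta> (sig_union \<Sigma> \<Delta>) id"
  using assms metric_sig_union[OF assms]
  by (auto simp: sig_embedding_def sig_embedding_axioms_def sig_union_def disjoint_sigs_def)

lemma itrs_embedding_union:
  assumes R: "is_itrs R" and S: "is_itrs S"
  shows "itrs_embedding R (itrs_union R S) id"
    and "disjoint_sigs (sig R) (sig S) \<Longrightarrow> itrs_embedding S (itrs_union R S) id"
proof -
  have "metric_sig (sig R)" "metric_sig (sig S)"
    using R S by (auto simp: is_itrs_def metric_sig_def)
  note emb = sig_embedding_union[OF this]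
  have sig: "sig (itrs_union R S) = sig_union (sig R) (sig S)"
    by (simp add: itrs_union_def Let_def)
  show "itrs_embedding R (itrs_union R S) id"
    using R emb(1) unfolding itrs_embedding_def itrs_embedding_axioms_def sig
    by (force simp: is_itrs_def itrs_union_def Let_def)
  show "itrs_embedding S (itrs_union R S) id" if "disjoint_sigs (sig R) (sig S)"
    using S emb(2)[OF that] unfolding itrs_embedding_def itrs_embedding_axioms_def sig
    by (force simp: is_itrs_def itrs_union_def Let_def)
qed

theorem theorem7p2:
  fixes R S :: "('f, 'v) itrs"
  assumes "is_itrs R" and "is_itrs S"
    and "disjoint_sigs (sig R) (sig S)"
  shows "(itrs_convergent TYPE('i) (itrs_union R S) \<longrightarrow>
            itrs_convergent TYPE('i) R \<and> itrs_convergent TYPE('i) S) \<and>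
         (strongly_convergent TYPE('i) (itrs_union R S) \<longrightarrow>
            strongly_convergent TYPE('i) R \<and> strongly_convergent TYPE('i) S)"
proof -
  interpret R: itrs_embedding R "itrs_union R S" id
    using assms by (intro itrs_embedding_union)
  interpret S: itrs_embedding S "itrs_union R S" id
    using assms by (intro itrs_embedding_union)
  show ?thesis
    using R.itrs_convergent_reflect S.itrs_convergent_reflect
      R.strongly_convergent_reflect S.strongly_convergent_reflect by blast
qed

end
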